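(* Let $X$ be a proper CAT(0) space with base point $\mathfrak o$, let $\kappa$ be as in the standing assumptions, and let $\mathbf b$ be an equivalence class of quasi-geodesic rays in $X$ under $\kappa$--fellow travelling. The following are equivalent: (1) $\mathbf b$ contains a geodesic ray $b$ that is $\kappa$--contracting; (2) every quasi-geodesic ray $\beta\in\mathbf b$ is $\kappa$--contracting; (3) every quasi-geodesic ray $\beta\in\mathbf b$ is $\kappa$--Morse; (4) there exists a quasi-geodesic ray $\beta\in\mathbf b$ that is $\kappa$--Morse; (5) $\mathbf b$ contains a geodesic ray $b$ that is $\kappa$--Morse for $(32,0)$--quasi-geodesics, i.e. there is a constant $M$ such that every $(32,0)$--quasi-geodesic segment with both end points on $b$ is contained in $\mathcal N_\kappa(b,M)$.
   Context: $X$ is a proper CAT(0) geodesic metric space with a fixed base point $\mathfrak o$; write $\|x\|=d_X(\mathfrak o,x)$. Fix $\kappa:[0,\infty)\to[1,\infty)$ monotone increasing, concave and sublinear ($\kappa(t)/t\to0$), and write $\kappa(x):=\kappa(\|x\|)$ for $x\in X$. A $(q,Q)$--quasi-geodesic is a continuous map $\beta$ from an interval to $X$ with $\frac1q|s-t|-Q\le d_X(\beta(s),\beta(t))\le q|s-t|+Q$; a (quasi-)geodesic ray is defined on $[0,\infty)$ and always satisfies $\beta(0)=\mathfrak o$. Quasi-geodesics are identified with their images when convenient. For a closed set $Z$, $x_Z$ denotes the set of nearest points of $Z$ to $x$ and $d_X(x,Z)$ the distance. The $(\kappa,n)$--neighbourhood is $\mathcal N_\kappa(Z,n)=\{x\in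 X: d_X(x,Z)\le n\,\kappa(x)\}$. Two quasi-geodesic rays $\beta,\gamma$ $\kappa$--fellow travel if each lies in some $(\kappa,n)$--neighbourhood of the other; this is an equivalence relation, with class $[\beta]$. A closed set $Z$ is $\kappa$--Morse if there is a function $m_Z:\mathbb R_+^2\to\mathbb R_+$ such that every $(q,Q)$--quasi-geodesic segment with end points on $Z$ lies in $\mathcal N_\kappa(Z,m_Z(q,Q))$. A closed set $Z$ is $\kappa$--contracting if there is a constant $c_Z$ such that for all $x,y\in X$ with $d_X(x,y)\le d_X(x,Z)$ we have $\operatorname{diam}(x_Z\cup y_Z)\le c_Z\,\kappa(x)$. A quasi-geodesic is called $\kappa$--Morse / $\kappa$--contracting if its image is. *)

theory Defs
  imports "HOL-Analysis.Analysis"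
begin

definition geodesic_segment :: "(real \<Rightarrow> 'a::metric_space) \<Rightarrow> 'a \<Rightarrow> 'a \<Rightarrow> bool" where
  "geodesic_segment g x y \<longleftrightarrow> g 0 = x \<and> g (dist x y) = y \<and>
     (\<forall>s\<in>{0..dist x y}. \<forall>t\<in>{0..dist x y}. dist (g s) (g t) = \<bar>s - t\<bar>)"

definition geodesic_space :: "'a::metric_space itself \<Rightarrow> bool" where
  "geodesic_space _ \<longleftrightarrow> (\<forall>x y::'a. \<exists>g. geodesic_segment g x y)"

definition proper_space :: "'a::metric_space itself \<Rightarrow> bool" where
  "proper_space _ \<longleftrightarrow> (\<forall>(x::'a) r. compact (cball x r))"

definition cmp_pt :: "complex \<Rightarrow> complex \<Rightarrow> real \<Rightarrow> real \<Rightarrow> complex" where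
  "cmp_pt a' b' L s = a' + complex_of_real (s / L) * (b' - a')"

text \<open>CAT(0) inequality (Bridson--Haefliger): for every geodesic triangle with sides
  g1 : [x,y], g2 : [y,z], g3 : [z,x], every comparison triangle x',y',z' in the Euclidean plane
  (= complex plane) with the same side lengths, and all points p,q on the triangle with
  comparison points p',q', one has d(p,q) \<le> |p'-q'|.\<close>
definition CAT0 :: "'a::metric_space itself \<Rightarrow> bool" where
  "CAT0 _ \<longleftrightarrow> geodesic_space TYPE('a) \<and>
    (\<forall>(x::'a) y z g1 g2 g3 x' y' z'.
       geodesic_segment g1 x y \<and> geodesic_segment g2 y z \<and> geodesic_segment g3 z x \<and>
       cmod (x' - y') = dist x y \<and> cmod (y' - z') = dist y z \<and> cmod (z' - x') = dist z x \<longrightarrow>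
       (let sides = [(g1, x', y', dist x y), (g2, y', z', dist y z), (g3, z', x', dist z x)] in
        \<forall>i<3. \<forall>j<3. \<forall>s t.
          (case sides ! i of (g, a', b', L) \<Rightarrow> case sides ! j of (h, c', d', L') \<Rightarrow>
             s \<in> {0..L} \<and> t \<in> {0..L'} \<longrightarrow>
             dist (g s) (h t) \<le> cmod (cmp_pt a' b' L s - cmp_pt c' d' L' t))))"

definition sublinear_fn :: "(real \<Rightarrow> real) \<Rightarrow> bool" where
  "sublinear_fn \<kappa> \<longleftrightarrow> mono_on {0..} \<kappa> \<and> concave_on {0..} \<kappa> \<and> (\<forall>t\<ge>0. \<kappa> t \<ge> 1) \<and>
     ((\<lambda>t. \<kappa> t / t) \<longlongrightarrow> 0) at_top"

definition kappa_nbhd :: "(real \<Rightarrow> real) \<Rightarrow> 'a::metric_space \<Rightarrow> 'a set \<Rightarrow> real \<Rightarrow> 'a set" where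
  "kappa_nbhd \<kappa> bp Z n = {x. infdist x Z \<le> n * \<kappa> (dist bp x)}"

definition qg_segment :: "real \<Rightarrow> real \<Rightarrow> (real \<Rightarrow> 'a::metric_space) \<Rightarrow> real \<Rightarrow> real \<Rightarrow> bool" where
  "qg_segment q Q \<beta> a b \<longleftrightarrow> a \<le> b \<and> continuous_on {a..b} \<beta> \<and>
     (\<forall>s\<in>{a..b}. \<forall>t\<in>{a..b}. \<bar>s - t\<bar> / q - Q \<le> dist (\<beta> s) (\<beta> t) \<and>
        dist (\<beta> s) (\<beta> t) \<le> q * \<bar>s - t\<bar> + Q)"

definition qg_ray_with :: "'a::metric_space \<Rightarrow> real \<Rightarrow> real \<Rightarrow> (real \<Rightarrow> 'a) \<Rightarrow> bool" where
  "qg_ray_with bp q Q \<beta> \<longleftrightarrow> \<beta> 0 = bp \<and> continuous_on {0..} \<beta> \<and>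
     (\<forall>s\<ge>0. \<forall>t\<ge>0. \<bar>s - t\<bar> / q - Q \<le> dist (\<beta> s) (\<beta> t) \<and>
        dist (\<beta> s) (\<beta> t) \<le> q * \<bar>s - t\<bar> + Q)"

definition qg_ray :: "'a::metric_space \<Rightarrow> (real \<Rightarrow> 'a) \<Rightarrow> bool" where
  "qg_ray bp \<beta> \<longleftrightarrow> (\<exists>q Q. q \<ge> 1 \<and> Q \<ge> 0 \<and> qg_ray_with bp q Q \<beta>)"

definition geodesic_ray :: "'a::metric_space \<Rightarrow> (real \<Rightarrow> 'a) \<Rightarrow> bool" where
  "geodesic_ray bp b \<longleftrightarrow> b 0 = bp \<and> (\<forall>s\<ge>0. \<forall>t\<ge>0. dist (b s) (b t) = \<bar>s - t\<bar>)"

definition ray_image :: "(real \<Rightarrow> 'a) \<Rightarrow> 'a set" where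
  "ray_image \<beta> = \<beta> ` {0..}"

definition kappa_fellow :: "(real \<Rightarrow> real) \<Rightarrow> 'a::metric_space \<Rightarrow> (real \<Rightarrow> 'a) \<Rightarrow> (real \<Rightarrow> 'a) \<Rightarrow> bool" where
  "kappa_fellow \<kappa> bp \<beta> \<gamma> \<longleftrightarrow>
     (\<exists>n. ray_image \<beta> \<subseteq> kappa_nbhd \<kappa> bp (ray_image \<gamma>) n) \<and>
     (\<exists>n. ray_image \<gamma> \<subseteq> kappa_nbhd \<kappa> bp (ray_image \<beta>) n)"

definition kappa_class :: "(real \<Rightarrow> real) \<Rightarrow> 'a::metric_space \<Rightarrow> (real \<Rightarrow> 'a) \<Rightarrow> (real \<Rightarrow> 'a) set" where
  "kappa_class \<kappa> bp \<beta>0 = {\<gamma>. qg_ray bp \<gamma> \<and> kappa_fellow \<kappa> bp \<beta>0 \<gamma>}"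

definition kappa_morse :: "(real \<Rightarrow> real) \<Rightarrow> 'a::metric_space \<Rightarrow> 'a set \<Rightarrow> bool" where
  "kappa_morse \<kappa> bp Z \<longleftrightarrow> closed Z \<and>
     (\<exists>m::real \<Rightarrow> real \<Rightarrow> real. \<forall>q Q \<alpha> a b. q \<ge> 1 \<and> Q \<ge> 0 \<and> qg_segment q Q \<alpha> a b \<and>
        \<alpha> a \<in> Z \<and> \<alpha> b \<in> Z \<longrightarrow> \<alpha> ` {a..b} \<subseteq> kappa_nbhd \<kappa> bp Z (m q Q))"

definition nearest_pts :: "'a::metric_space \<Rightarrow> 'a set \<Rightarrow> 'a set" where
  "nearest_pts x Z = {z\<in>Z. dist x z = infdist x Z}"

definition kappa_contracting :: "(real \<Rightarrow> real) \<Rightarrow> 'a::metric_space \<Rightarrow> 'a set \<Rightarrow> bool" where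
  "kappa_contracting \<kappa> bp Z \<longleftrightarrow> closed Z \<and>
     (\<exists>c. \<forall>x y. dist x y \<le> infdist x Z \<longrightarrow>
        diameter (nearest_pts x Z \<union> nearest_pts y Z) \<le> c * \<kappa> (dist bp x))"

end

theory Submission
  imports Defs
begin

text \<open>The key implications hold for all closed sets \<open>Z\<close> containing the base point, not only for rays.
  If \<open>Z\<close> is contracting, a quasi-geodesic far from \<open>Z\<close> has slowly moving projection, so its
  excursions away from \<open>Z\<close> are short: \<open>Z\<close> is Morse. Contraction passes to any closed set at sublinear
  distance, as nearest points on the two sets are sublinearly close. Conversely, let \<open>Z\<close> be Morse for
  \<open>(32,0)\<close>-quasi-geodesics and let \<open>x, y\<close> have nearest points \<open>p, r\<close> in \<open>Z\<close> with
  \<open>dist x y \<le> dist x p\<close> and \<open>D = dist p r\<close>. The CAT(0) inequality yields a point \<open>x'\<close> at distance \<open>D / 8\<close>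
  from \<open>p\<close> on \<open>[p,x]\<close> (or from \<open>r\<close> on \<open>[r,y]\<close>) whose distance to the other nearest point is at most
  \<open>11 / 10 * D\<close>. Shortcutting the corner of \<open>[p,x'] \<union> [x',r]\<close> gives a
  \<open>(32,0)\<close>-quasi-geodesic that still reaches distance \<open>D / 250\<close> from \<open>Z\<close>, which bounds \<open>D\<close>. Finally, the
  class of a Morse ray contains a geodesic ray, obtained as a limit of geodesics to its points.\<close>

section \<open>Sublinear functions\<close>

lemma sublinear_mono: "sublinear_fn \<kappa> \<Longrightarrow> 0 \<le> s \<Longrightarrow> s \<le> t \<Longrightarrow> \<kappa> s \<le> \<kappa> t"
  by (auto simp: sublinear_fn_def mono_on_def)

lemma sublinear_ge_1: "sublinear_fn \<kappa> \<Longrightarrow> 0 \<le> t \<Longrightarrow> 1 \<le> \<kappa> t"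
  by (simp add: sublinear_fn_def)

text \<open>Concavity between 0 and \<open>s + t\<close>, together with
  \<open>\<kappa> 0 \<ge> 0\<close>, bounds \<open>\<kappa> r\<close> below by the fraction
  \<open>r / (s + t)\<close> of \<open>\<kappa> (s + t)\<close>; the fractions for \<open>s\<close>
  and \<open>t\<close> sum to 1.\<close>

lemma sublinear_add:
  assumes "sublinear_fn \<kappa>" "0 \<le> s" "0 \<le> t"
  shows "\<kappa> (s + t) \<le> \<kappa> s + \<kappa> t"
proof (cases "s + t = 0")
  case True
  then show ?thesis
    using assms sublinear_ge_1[OF assms(1), of 0] by (simp add: add_nonneg_eq_0_iff)
next
  case False
  have c: "concave_on {0..} \<kappa>"
    using assms(1) by (simp add: sublinear_fn_def)
  have scale: "r / (s + t) * \<kappa> (s + t) \<le> \<kappa> r" if "0 \<le> r" "r \<le> s + t" for r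
  proof -
    have "(1 - r / (s + t)) * \<kappa> 0 + r / (s + t) * \<kappa> (s + t)
        \<le> \<kappa> ((1 - r / (s + t)) *\<^sub>R 0 + (r / (s + t)) *\<^sub>R (s + t))"
      by (rule concave_onD[OF c]) (use that assms in \<open>auto simp: divide_simps\<close>)
    moreover have "0 \<le> (1 - r / (s + t)) * \<kappa> 0"
      using that sublinear_ge_1[OF assms(1), of 0] False by (intro mult_nonneg_nonneg) (auto simp: divide_simps)
    ultimately show ?thesis
      using False by simp
  qed
  have "\<kappa> (s + t) = s / (s + t) * \<kappa> (s + t) + t / (s + t) * \<kappa> (s + t)"
    using False by (simp flip: distrib_right add_divide_distrib)
  also have "\<dots> \<le> \<kappa> s + \<kappa> t"
    using scale[of s] scale[of t] assms by simp
  finally show ?thesis .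
qed

lemma sublinear_double: "sublinear_fn \<kappa> \<Longrightarrow> 0 \<le> t \<Longrightarrow> \<kappa> (2 * t) \<le> 2 * \<kappa> t"
  using sublinear_add[of \<kappa> t t] by simp

text \<open>Quantitative form of sublinearity, used to absorb terms in \<open>\<kappa>\<close>: past
  some \<open>T\<close> the ratio is below \<open>\<epsilon>\<close>, and before \<open>T\<close>
  monotonicity supplies the constant \<open>\<kappa> T\<close>.\<close>

lemma sublinear_linear_bound:
  assumes "sublinear_fn \<kappa>" "0 < \<epsilon>"
  obtains c where "0 \<le> c" "\<And>t. 0 \<le> t \<Longrightarrow> \<kappa> t \<le> \<epsilon> * t + c"
proof -
  have "eventually (\<lambda>t. \<kappa> t / t < \<epsilon>) at_top"
    using assms order_tendstoD(2) by (auto simp: sublinear_fn_def)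
  then obtain T0 where T0: "\<And>t. T0 \<le> t \<Longrightarrow> \<kappa> t / t < \<epsilon>"
    by (auto simp: eventually_at_top_linorder)
  define T where "T = max T0 1"
  have "\<kappa> t \<le> \<epsilon> * t + \<kappa> T" if "0 \<le> t" for t
  proof (cases "t \<le> T")
    case True
    then have "\<kappa> t \<le> \<kappa> T"
      using sublinear_mono[OF assms(1) that] by blast
    then show ?thesis
      using that assms(2) by (simp add: add_increasing)
  next
    case False
    then have "\<kappa> t / t < \<epsilon>" "0 < t"
      using T0[of t] by (auto simp: T_def)
    then have "\<kappa> t < \<epsilon> * t"
      by (simp add: pos_divide_less_eq)
    moreover have "0 \<le> T"
      by (simp add: T_def)
    ultimately show ?thesis
      using sublinear_ge_1[OF assms(1), of T] by linarith
  qed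
  moreover have "0 \<le> \<kappa> T"
    using order_trans[OF zero_le_one sublinear_ge_1[OF assms(1), of T]] by (simp add: T_def)
  ultimately show ?thesis
    using that by blast
qed

text \<open>This allows \<open>\<kappa>\<close> to be evaluated at either of two points whose
  distance is of order \<open>\<kappa>\<close>. By subadditivity the two values differ by at most
  \<open>\<kappa>\<close> of that distance, which sublinearity bounds by half of
  \<open>\<kappa> (dist bp x)\<close> plus a constant, and constants are absorbed because
  \<open>\<kappa> \<ge> 1\<close>.\<close>

lemma sublinear_comparable:
  assumes "sublinear_fn \<kappa>"
  obtains K where "1 \<le> K"
    "\<And>x y bp::'a::metric_space. dist x y \<le> C * \<kappa> (dist bp x) \<Longrightarrow>
       \<kappa> (dist bp y) \<le> K * \<kappa> (dist bp x) \<and> \<kappa> (dist bp x) \<le> K * \<kappa> (dist bp y)"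
proof -
  define D where "D = max C 0"
  have D: "0 \<le> D"
    by (simp add: D_def)
  \<comment> \<open>With this slope the linear part of \<open>\<kappa> (D * ?a)\<close> is at most
    \<open>?a / 2\<close>.\<close>
  obtain c where c: "0 \<le> c" "\<And>t. 0 \<le> t \<Longrightarrow> \<kappa> t \<le> 1 / (2 * (D + 1)) * t + c"
    using sublinear_linear_bound[OF assms, of "1 / (2 * (D + 1))"] D by auto
  have *: "\<kappa> (dist bp y) \<le> (2 + 2 * c) * \<kappa> (dist bp x) \<and> \<kappa> (dist bp x) \<le> (2 + 2 * c) * \<kappa> (dist bp y)"
    if "dist x y \<le> C * \<kappa> (dist bp x)" for x y bp :: 'a
  proof -
    let ?a = "\<kappa> (dist bp x)" and ?b = "\<kappa> (dist bp y)"
    have ab: "1 \<le> ?a" "1 \<le> ?b"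
      using sublinear_ge_1[OF assms] by auto
    have d: "dist x y \<le> D * ?a"
      using that ab(1) mult_right_mono[of C D ?a] unfolding D_def by linarith
    have "\<kappa> (D * ?a) \<le> 1 / (2 * (D + 1)) * (D * ?a) + c"
      using c(2)[of "D * ?a"] D ab by simp
    also have "1 / (2 * (D + 1)) * (D * ?a) = (D / (D + 1)) * (?a / 2)"
      using D by (simp add: field_simps)
    also have "\<dots> \<le> 1 * (?a / 2)"
      using D ab by (intro mult_right_mono) auto
    finally have k: "\<kappa> (D * ?a) \<le> ?a / 2 + c"
      by simp
    have "?b \<le> \<kappa> (dist bp x + D * ?a)"
      using dist_triangle[of bp y x] d by (intro sublinear_mono[OF assms]) (auto simp: dist_commute)
    also have "\<dots> \<le> ?a + \<kappa> (D * ?a)"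
      using D ab by (intro sublinear_add[OF assms]) auto
    finally have 1: "?b \<le> 3 / 2 * ?a + c"
      using k by simp
    have "?a \<le> \<kappa> (dist bp y + D * ?a)"
      using dist_triangle[of bp x y] d by (intro sublinear_mono[OF assms]) (auto simp: dist_commute)
    also have "\<dots> \<le> ?b + \<kappa> (D * ?a)"
      using D ab by (intro sublinear_add[OF assms]) auto
    finally have 2: "?a \<le> 2 * ?b + 2 * c"
      using k by simp
    have "c * 1 \<le> c * ?a" "c * 1 \<le> c * ?b"
      using c(1) ab by (intro mult_left_mono; simp)+
    then show ?thesis
      using 1 2 ab by (simp add: algebra_simps)
  qed
  show ?thesis
    by (rule that[of "2 + 2 * c"]) (use c(1) * in auto)
qed

section \<open>Nearest points and sublinear neighbourhoods\<close>

lemma nearest_pts_nonempty: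
  fixes Z :: "'a::metric_space set"
  assumes "proper_space TYPE('a)" "closed Z" "Z \<noteq> {}"
  obtains p where "p \<in> nearest_pts x Z"
proof -
  obtain z where z: "z \<in> Z"
    using assms by blast
  define S where "S = cball x (dist x z) \<inter> Z"
  have "compact S"
    using assms by (auto simp: S_def proper_space_def compact_Int_closed)
  moreover have "z \<in> S"
    using z by (simp add: S_def)
  ultimately obtain p where p: "p \<in> S" "\<And>y. y \<in> S \<Longrightarrow> dist x p \<le> dist x y"
    using continuous_attains_inf[of S "dist x", OF _ _ continuous_on_dist[OF continuous_on_const continuous_on_id]]
    by blast
  have "dist x p \<le> dist x y" if "y \<in> Z" for y
    using p(2)[of y] p(2)[OF \<open>z \<in> S\<close>] that by (cases "dist x y \<le> dist x z") (auto simp: S_def)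
  then have "dist x p \<le> infdist x Z"
    using assms(3) by (auto simp: infdist_def intro: cINF_greatest)
  then show ?thesis
    using p(1) infdist_le[of p Z x] by (intro that[of p]) (auto simp: nearest_pts_def S_def)
qed

lemma nearest_ptsD:
  assumes "p \<in> nearest_pts x Z"
  shows "p \<in> Z" "dist x p = infdist x Z"
  using assms by (auto simp: nearest_pts_def)

lemma bounded_nearest_pts: "bounded (nearest_pts x Z)"
  by (rule bounded_subset[of "cball x (infdist x Z)"]) (auto simp: nearest_pts_def)

lemma dist_nearest_pts_le:
  assumes "p \<in> nearest_pts x Z" "bp \<in> Z"
  shows "dist x p \<le> dist bp x"
  using nearest_ptsD(2)[OF assms(1)] infdist_le[OF assms(2), of x] by (simp add: dist_commute)

lemma infdist_lt_obtain:
  assumes "Z \<noteq> {}" "infdist x Z < r"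
  obtains z where "z \<in> Z" "dist x z < r"
proof -
  have "(INF a\<in>Z. dist x a) < r"
    using assms by (simp add: infdist_def)
  then show ?thesis
    using assms(1) that by (meson cINF_less_iff bdd_below_image_dist)
qed

text \<open>Since \<open>\<kappa> \<ge> 1\<close>, raising \<open>n\<close> by 1 makes the bound on
  the infimum strict, which leaves room for an actual point of \<open>Z\<close>.\<close>

lemma kappa_nbhd_obtain:
  fixes bp :: "'a::metric_space"
  assumes "sublinear_fn \<kappa>" "x \<in> kappa_nbhd \<kappa> bp Z n" "Z \<noteq> {}"
  obtains z where "z \<in> Z" "dist x z \<le> (n + 1) * \<kappa> (dist bp x)"
proof -
  have "infdist x Z < (n + 1) * \<kappa> (dist bp x)"
    using assms(2) sublinear_ge_1[OF assms(1), of "dist bp x"]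
    by (simp add: kappa_nbhd_def algebra_simps)
  then show ?thesis
    using infdist_lt_obtain[OF assms(3)] that by (metis less_imp_le)
qed

lemma kappa_nbhd_trans:
  fixes bp :: "'a::metric_space"
  assumes "sublinear_fn \<kappa>" "Y \<noteq> {}" "Y \<subseteq> kappa_nbhd \<kappa> bp Z n"
  obtains k where "kappa_nbhd \<kappa> bp Y m \<subseteq> kappa_nbhd \<kappa> bp Z k"
proof -
  obtain K where K: "1 \<le> K" "\<And>x y bp::'a. dist x y \<le> (m + 1) * \<kappa> (dist bp x) \<Longrightarrow>
       \<kappa> (dist bp y) \<le> K * \<kappa> (dist bp x) \<and> \<kappa> (dist bp x) \<le> K * \<kappa> (dist bp y)"
    using sublinear_comparable[OF assms(1), where C="m + 1" and 'a='a] by blast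
  have "x \<in> kappa_nbhd \<kappa> bp Z (m + 1 + \<bar>n\<bar> * K)" if x: "x \<in> kappa_nbhd \<kappa> bp Y m" for x
  proof -
    obtain y where y: "y \<in> Y" "dist x y \<le> (m + 1) * \<kappa> (dist bp x)"
      using kappa_nbhd_obtain[OF assms(1) x assms(2)] by blast
    have "infdist y Z \<le> n * \<kappa> (dist bp y)"
      using y assms(3) by (auto simp: kappa_nbhd_def)
    also have "\<dots> \<le> \<bar>n\<bar> * (K * \<kappa> (dist bp x))"
      using K(2)[OF y(2)] sublinear_ge_1[OF assms(1), of "dist bp y"] by (intro mult_mono) auto
    finally show ?thesis
      using infdist_triangle[of x Z y] y(2) by (simp add: kappa_nbhd_def algebra_simps)
  qed
  then show ?thesis
    using that by blast
qed

lemma kappa_fellow_trans: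
  assumes "sublinear_fn \<kappa>" "kappa_fellow \<kappa> bp \<alpha> \<beta>" "kappa_fellow \<kappa> bp \<beta> \<gamma>"
  shows "kappa_fellow \<kappa> bp \<alpha> \<gamma>"
proof -
  have ne: "ray_image \<delta> \<noteq> {}" for \<delta> :: "real \<Rightarrow> 'a"
    by (auto simp: ray_image_def)
  have *: "\<exists>n. ray_image \<alpha> \<subseteq> kappa_nbhd \<kappa> bp (ray_image \<gamma>) n"
    if "ray_image \<alpha> \<subseteq> kappa_nbhd \<kappa> bp (ray_image \<beta>) n" "ray_image \<beta> \<subseteq> kappa_nbhd \<kappa> bp (ray_image \<gamma>) m"
    for \<alpha> \<beta> \<gamma> n m
    using kappa_nbhd_trans[OF assms(1) ne that(2)] that(1) by (meson order_trans)
  show ?thesis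
    using assms(2,3) unfolding kappa_fellow_def by (meson *)
qed

lemma kappa_fellow_sym: "kappa_fellow \<kappa> bp \<alpha> \<beta> \<longleftrightarrow> kappa_fellow \<kappa> bp \<beta> \<alpha>"
  by (auto simp: kappa_fellow_def)

text \<open>Contraction with its constant exposed and without diameters. Only a nearest point of
  \<open>x\<close> and one of \<open>y\<close> are compared; the case \<open>y = x\<close> recovers
  the spread of the nearest points of \<open>x\<close>.\<close>

definition contracting_with :: "(real \<Rightarrow> real) \<Rightarrow> 'a::metric_space \<Rightarrow> real \<Rightarrow> 'a set \<Rightarrow> bool" where
  "contracting_with \<kappa> bp c Z \<longleftrightarrow> (\<forall>x y. dist x y \<le> infdist x Z \<longrightarrow>
     (\<forall>p\<in>nearest_pts x Z. \<forall>q\<in>nearest_pts y Z. dist p q \<le> c * \<kappa> (dist bp x)))"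

lemma contracting_withD:
  assumes "contracting_with \<kappa> bp c Z" "dist x y \<le> infdist x Z"
    "p \<in> nearest_pts x Z" "q \<in> nearest_pts y Z"
  shows "dist p q \<le> c * \<kappa> (dist bp x)"
  using assms by (auto simp: contracting_with_def)

text \<open>For the converse direction, the whole union lies within
  \<open>c * \<kappa> (dist bp x)\<close> of a single nearest point of \<open>x\<close>, so its
  diameter is at most twice that.\<close>

lemma kappa_contracting_iff:
  fixes bp :: "'a::metric_space"
  assumes "sublinear_fn \<kappa>" "proper_space TYPE('a)" "Z \<noteq> {}"
  shows "kappa_contracting \<kappa> bp Z \<longleftrightarrow> closed Z \<and> (\<exists>c\<ge>1. contracting_with \<kappa> bp c Z)"
proof safe
  assume Z: "kappa_contracting \<kappa> bp Z"
  then show "closed Z"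
    by (simp add: kappa_contracting_def)
  obtain c where c: "\<And>x y. dist x y \<le> infdist x Z \<Longrightarrow>
        diameter (nearest_pts x Z \<union> nearest_pts y Z) \<le> c * \<kappa> (dist bp x)"
    using Z by (auto simp: kappa_contracting_def)
  have "dist p q \<le> max c 1 * \<kappa> (dist bp x)"
    if "dist x y \<le> infdist x Z" "p \<in> nearest_pts x Z" "q \<in> nearest_pts y Z" for x y p q
  proof -
    have "dist p q \<le> diameter (nearest_pts x Z \<union> nearest_pts y Z)"
      using that by (intro diameter_bounded_bound) (auto simp: bounded_nearest_pts)
    also have "\<dots> \<le> c * \<kappa> (dist bp x)"
      by (rule c[OF that(1)])
    also have "\<dots> \<le> max c 1 * \<kappa> (dist bp x)"
      using sublinear_ge_1[OF assms(1), of "dist bp x"] by (intro mult_right_mono) auto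
    finally show ?thesis .
  qed
  then show "\<exists>c\<ge>1. contracting_with \<kappa> bp c Z"
    unfolding contracting_with_def by (intro exI[of _ "max c 1"]) auto
next
  fix c :: real
  assume cl: "closed Z" and "1 \<le> c" and c: "contracting_with \<kappa> bp c Z"
  have "diameter (nearest_pts x Z \<union> nearest_pts y Z) \<le> (2 * c) * \<kappa> (dist bp x)"
    if xy: "dist x y \<le> infdist x Z" for x y
  proof -
    define k where "k = c * \<kappa> (dist bp x)"
    have k: "0 \<le> k"
      using \<open>1 \<le> c\<close> sublinear_ge_1[OF assms(1), of "dist bp x"] by (simp add: k_def)
    have xx: "dist x x \<le> infdist x Z"
      by (simp add: infdist_nonneg)
    obtain p where p: "p \<in> nearest_pts x Z"
      using nearest_pts_nonempty[OF assms(2) cl assms(3)] .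
    have near: "dist p q \<le> k" if "q \<in> nearest_pts x Z \<union> nearest_pts y Z" for q
      using contracting_withD[OF c xx p] contracting_withD[OF c xy p] that by (auto simp: k_def)
    have "dist q r \<le> 2 * k"
      if "q \<in> nearest_pts x Z \<union> nearest_pts y Z" "r \<in> nearest_pts x Z \<union> nearest_pts y Z" for q r
      using near[OF that(1)] near[OF that(2)] dist_triangle3[of q r p] by linarith
    then have "(SUP (q, r)\<in>(nearest_pts x Z \<union> nearest_pts y Z) \<times> (nearest_pts x Z \<union> nearest_pts y Z). dist q r) \<le> 2 * k"
      using p by (intro cSUP_least) auto
    then show ?thesis
      using p by (auto simp: diameter_def k_def algebra_simps)
  qed
  then show "kappa_contracting \<kappa> bp Z"
    using cl by (auto simp: kappa_contracting_def intro!: exI[of _ "2 * c"])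
qed

section \<open>Geodesics and quasi-geodesic segments\<close>

lemma geodesic_segmentD:
  assumes "geodesic_segment g x y"
  shows "g 0 = x" "g (dist x y) = y"
    "s \<in> {0..dist x y} \<Longrightarrow> t \<in> {0..dist x y} \<Longrightarrow> dist (g s) (g t) = \<bar>s - t\<bar>"
  using assms by (auto simp: geodesic_segment_def)

lemma geodesic_segment_dist:
  assumes "geodesic_segment g x y" "s \<in> {0..dist x y}"
  shows "dist x (g s) = s" "dist (g s) y = dist x y - s"
  using geodesic_segmentD[OF assms(1)] geodesic_segmentD(3)[OF assms(1), of 0 s]
    geodesic_segmentD(3)[OF assms(1), of s "dist x y"] assms(2) by auto

lemma geodesic_segment_reverse:
  assumes "geodesic_segment g x y"
  shows "geodesic_segment (\<lambda>t. g (dist x y - t)) y x"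
  using geodesic_segmentD[OF assms] by (auto simp: geodesic_segment_def dist_commute)

text \<open>A point of \<open>Z\<close> closer than \<open>s\<close> to \<open>g s\<close> would be
  closer to \<open>x\<close> than \<open>p\<close> is.\<close>

lemma geodesic_segment_infdist:
  assumes "geodesic_segment g p x" "p \<in> nearest_pts x Z" "s \<in> {0..dist p x}"
  shows "s \<le> infdist (g s) Z"
  using infdist_triangle[of x Z "g s"] nearest_ptsD(2)[OF assms(2)]
    geodesic_segment_dist[OF assms(1,3)] by (simp add: dist_commute)

lemma isometric_continuous_on:
  assumes "\<And>s t. s \<in> S \<Longrightarrow> t \<in> S \<Longrightarrow> dist (\<alpha> s) (\<alpha> t) = \<bar>s - t\<bar>"
  shows "continuous_on S (\<alpha> :: real \<Rightarrow> 'a::metric_space)"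
proof (unfold continuous_on_iff, intro ballI allI impI)
  fix s e assume "s \<in> S" "0 < (e :: real)"
  then show "\<exists>d>0. \<forall>t\<in>S. dist t s < d \<longrightarrow> dist (\<alpha> t) (\<alpha> s) < e"
    using assms by (intro exI[of _ e]) (simp add: dist_real_def)
qed

lemma isometric_qg_segment:
  assumes "\<And>s t. s \<in> {a..b} \<Longrightarrow> t \<in> {a..b} \<Longrightarrow> dist (\<alpha> s) (\<alpha> t) = \<bar>s - t\<bar>"
    and "a \<le> b" "1 \<le> q" "0 \<le> Q"
  shows "qg_segment q Q \<alpha> a b"
proof -
  have "d / q - Q \<le> d \<and> d \<le> q * d + Q" if "0 \<le> d" for d :: real
  proof -
    have "1 * d \<le> q * d"
      using assms that by (intro mult_right_mono) auto
    moreover have "d / q \<le> d"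
      using assms calculation by (simp add: pos_divide_le_eq mult.commute)
    ultimately show ?thesis
      using assms(4) by simp
  qed
  then show ?thesis
    using assms(1,2) isometric_continuous_on[of "{a..b}" \<alpha>] by (simp add: qg_segment_def)
qed

lemma qg_segmentD:
  assumes "qg_segment q Q \<alpha> a b" "a \<le> s" "s \<le> t" "t \<le> b"
  shows "(t - s) / q - Q \<le> dist (\<alpha> s) (\<alpha> t)" "dist (\<alpha> s) (\<alpha> t) \<le> q * (t - s) + Q"
proof -
  have "s \<in> {a..b}" "t \<in> {a..b}"
    using assms by auto
  then have "\<bar>s - t\<bar> / q - Q \<le> dist (\<alpha> s) (\<alpha> t) \<and> dist (\<alpha> s) (\<alpha> t) \<le> q * \<bar>s - t\<bar> + Q"
    using assms(1) unfolding qg_segment_def by blast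
  then show "(t - s) / q - Q \<le> dist (\<alpha> s) (\<alpha> t)" "dist (\<alpha> s) (\<alpha> t) \<le> q * (t - s) + Q"
    using assms(3) by (simp_all add: abs_minus_commute)
qed

lemma qg_segment_join:
  assumes "qg_segment q Q \<alpha> a b" "qg_segment q Q \<beta> b c" "\<alpha> b = \<beta> b"
    and cross: "\<And>s t. s \<in> {a..b} \<Longrightarrow> t \<in> {b..c} \<Longrightarrow>
      (t - s) / q - Q \<le> dist (\<alpha> s) (\<beta> t) \<and> dist (\<alpha> s) (\<beta> t) \<le> q * (t - s) + Q"
  shows "qg_segment q Q (\<lambda>t. if t \<le> b then \<alpha> t else \<beta> t) a c"
proof -
  let ?\<gamma> = "\<lambda>t. if t \<le> b then \<alpha> t else \<beta> t"
  have abc: "a \<le> b" "b \<le> c"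
    using assms by (auto simp: qg_segment_def)
  have "continuous_on ({a..b} \<union> {b..c}) ?\<gamma>"
  proof (rule continuous_on_If)
    show "\<alpha> t = \<beta> t" if "t \<in> {a..b}" "\<not> t \<le> b" for t
      using that by simp
    show "\<alpha> t = \<beta> t" if "t \<in> {b..c}" "t \<le> b" for t
      using that assms(3) by (metis atLeastAtMost_iff order_antisym)
  qed (use assms in \<open>auto simp: qg_segment_def\<close>)
  then have cont: "continuous_on {a..c} ?\<gamma>"
    using abc by (simp add: ivl_disj_un_two_touch)
  have bound: "(t - s) / q - Q \<le> dist (?\<gamma> s) (?\<gamma> t) \<and> dist (?\<gamma> s) (?\<gamma> t) \<le> q * (t - s) + Q"
    if st: "a \<le> s" "s \<le> t" "t \<le> c" for s t
  proof -
    consider "t \<le> b" | "s \<le> b" "b < t" | "b < s"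
      by linarith
    then show ?thesis
    proof cases
      case 1
      then show ?thesis
        using qg_segmentD[OF assms(1), of s t] st by simp
    next
      case 2
      then show ?thesis
        using cross[of s t] st by auto
    next
      case 3
      then show ?thesis
        using qg_segmentD[OF assms(2), of s t] st by simp
    qed
  qed
  have "\<bar>s - t\<bar> / q - Q \<le> dist (?\<gamma> s) (?\<gamma> t) \<and> dist (?\<gamma> s) (?\<gamma> t) \<le> q * \<bar>s - t\<bar> + Q"
    if "s \<in> {a..c}" "t \<in> {a..c}" for s t
    using bound[of s t] bound[of t s] that by (cases "s \<le> t") (auto simp: dist_commute abs_minus_commute)
  then show ?thesis
    using cont abc unfolding qg_segment_def by auto
qed

text \<open>Of all pairs of points on the two sides of the corner at \<open>x\<close> whose distance is at most
  \<open>1 / q\<close> times the length of the path between them, a pair cutting off a path of maximal length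
  is chosen; maximality makes the shortened path quasi-geodesic.\<close>

lemma geodesic_corner_shortcut:
  fixes g h :: "real \<Rightarrow> 'a::metric_space"
  assumes "geodesic_space TYPE('a)" "1 \<le> q"
    and g: "geodesic_segment g p x" and h: "geodesic_segment h x r"
  obtains a e \<alpha> T where "a \<in> {0..dist p x}" "e \<in> {0..dist x r}"
    "q * dist (g a) (h e) \<le> dist p x - a + e"
    "qg_segment q 0 \<alpha> 0 T" "\<alpha> 0 = p" "\<alpha> T = r" "a \<in> {0..T}" "\<alpha> a = g a"
proof -
  define u L where "u = dist p x" and "L = dist x r"
  have gd: "dist (g s) (g t) = \<bar>s - t\<bar>" if "s \<in> {0..u}" "t \<in> {0..u}" for s t
    using geodesic_segmentD(3)[OF g] that by (simp add: u_def)
  have hd: "dist (h s) (h t) = \<bar>s - t\<bar>" if "s \<in> {0..L}" "t \<in> {0..L}" for s t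
    using geodesic_segmentD(3)[OF h] that by (simp add: L_def)
  have uL: "0 \<le> u" "0 \<le> L"
    by (auto simp: u_def L_def)
  \<comment> \<open>The parameter of \<open>g\<close> is measured from \<open>p\<close> and that of
    \<open>h\<close> from the corner, so \<open>u - fst z + snd z\<close> is the length of the path
    through the corner. The corner itself is the pair \<open>(u, 0)\<close>.\<close>
  define S where "S = {z \<in> {0..u} \<times> {0..L}. q * dist (g (fst z)) (h (snd z)) \<le> u - fst z + snd z}"
  have cg: "continuous_on ({0..u} \<times> {0..L}) (\<lambda>z. g (fst z))"
    by (rule continuous_on_compose2[of "{0..u}" g _ fst, OF isometric_continuous_on[OF gd]]) (auto intro!: continuous_intros)
  have ch: "continuous_on ({0..u} \<times> {0..L}) (\<lambda>z. h (snd z))"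
    by (rule continuous_on_compose2[of "{0..L}" h _ snd, OF isometric_continuous_on[OF hd]]) (auto intro!: continuous_intros)
  have "closed S"
    unfolding S_def using cg ch
    by (intro continuous_on_closed_Collect_le continuous_intros closed_Times) auto
  moreover have "bounded S"
    by (rule bounded_subset[of "{0..u} \<times> {0..L}"]) (auto simp: S_def bounded_Times)
  ultimately have "compact S"
    by (simp add: compact_eq_bounded_closed)
  moreover have sup_cont: "continuous_on S (\<lambda>w. u - fst w + snd w)"
    by (intro continuous_intros)
  moreover have "(u, 0) \<in> S"
    using uL geodesic_segmentD[OF g] geodesic_segmentD[OF h] by (auto simp: S_def u_def)
  ultimately obtain z where z: "z \<in> S" "\<And>w. w \<in> S \<Longrightarrow> u - fst w + snd w \<le> u - fst z + snd z"
    using continuous_attains_sup[of S "\<lambda>w. u - fst w + snd w", OF _ _ sup_cont] by blast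
  obtain a e where ae: "z = (a, e)"
    by (cases z)
  have a: "a \<in> {0..u}" and e: "e \<in> {0..L}" and short: "q * dist (g a) (h e) \<le> u - a + e"
    using z(1) by (auto simp: ae S_def)
  define \<sigma> where "\<sigma> = dist (g a) (h e)"
  have \<sigma>: "0 \<le> \<sigma>"
    by (simp add: \<sigma>_def)
  \<comment> \<open>A pair further out cuts off more, so by maximality it violates the inequality
    defining \<open>S\<close>. Comparison with the inequality for \<open>(a, e)\<close> leaves this
    bound, the source of the lower quasi-geodesic estimates across the joints.\<close>
  have far: "(a - a') / q + \<sigma> + (e' - e) / q \<le> dist (g a') (h e')"
    if "a' \<in> {0..a}" "e' \<in> {e..L}" for a' e'
  proof (cases "a' = a \<and> e' = e")
    case True
    then show ?thesis
      by (simp add: \<sigma>_def)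
  next
    case False
    have "(a', e') \<notin> S"
      using z(2)[of "(a', e')"] that False by (auto simp: ae)
    then have "u - a' + e' < q * dist (g a') (h e')"
      using that a e by (auto simp: S_def)
    then have "(a - a') + q * \<sigma> + (e' - e) \<le> q * dist (g a') (h e')"
      using short by (simp add: \<sigma>_def)
    then have "((a - a') + q * \<sigma> + (e' - e)) / q \<le> dist (g a') (h e')"
      using assms(2) by (simp add: pos_divide_le_eq mult.commute)
    moreover have "((a - a') + q * \<sigma> + (e' - e)) / q = (a - a') / q + \<sigma> + (e' - e) / q"
      using assms(2) by (simp add: add_divide_distrib)
    ultimately show ?thesis
      by simp
  qed
  obtain k where k: "geodesic_segment k (g a) (h e)"
    using assms(1) by (auto simp: geodesic_space_def)
  have kd: "dist (k s) (k t) = \<bar>s - t\<bar>" if "s \<in> {0..\<sigma>}" "t \<in> {0..\<sigma>}" for s t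
    using geodesic_segmentD(3)[OF k] that by (simp add: \<sigma>_def)
  have k0: "k 0 = g a" "k \<sigma> = h e"
    using geodesic_segmentD[OF k] by (auto simp: \<sigma>_def)
  have dq: "d / q \<le> d \<and> d \<le> q * d" if "0 \<le> d" for d :: real
    using that assms(2) mult_right_mono[of 1 q d] by (simp add: pos_divide_le_eq mult.commute)
  \<comment> \<open>The path follows \<open>g\<close> up to \<open>a\<close>, the bridge
    \<open>k\<close> up to \<open>a + \<sigma>\<close>, and then \<open>h\<close> from
    \<open>e\<close> on; \<open>\<beta>\<close> and \<open>\<gamma>\<close> are the last two pieces,
    reparametrised.\<close>
  define \<beta> where "\<beta> t = k (t - a)" for t
  define \<gamma> where "\<gamma> t = h (t - (a + \<sigma>) + e)" for t
  define \<delta> where "\<delta> t = (if t \<le> a then g t else \<beta> t)" for t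
  define T where "T = a + \<sigma> + (L - e)"
  have \<delta>: "qg_segment q 0 \<delta> 0 (a + \<sigma>)"
    unfolding \<delta>_def
  proof (rule qg_segment_join)
    show "qg_segment q 0 g 0 a" "qg_segment q 0 \<beta> a (a + \<sigma>)"
      using a \<sigma> assms(2) by (auto intro!: isometric_qg_segment simp: gd kd \<beta>_def)
    show "g a = \<beta> a"
      by (simp add: \<beta>_def k0)
    fix s t assume st: "s \<in> {0..a}" "t \<in> {a..a + \<sigma>}"
    have "(a - s) / q + \<sigma> \<le> dist (g s) (h e)"
      using far[of s e] st e by simp
    moreover have "dist (\<beta> t) (h e) = a + \<sigma> - t" "dist (g a) (\<beta> t) = t - a"
      using kd[of "t - a" \<sigma>] kd[of 0 "t - a"] st \<sigma> by (auto simp: \<beta>_def k0)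
    moreover have "dist (g s) (g a) = a - s"
      using gd[of s a] st a by simp
    moreover have "(t - s) / q = (a - s) / q + (t - a) / q" "(t - a) / q \<le> t - a" "t - s \<le> q * (t - s)"
      using dq[of "t - a"] dq[of "t - s"] st by (auto simp: diff_divide_distrib)
    ultimately show "(t - s) / q - 0 \<le> dist (g s) (\<beta> t) \<and> dist (g s) (\<beta> t) \<le> q * (t - s) + 0"
      using dist_triangle[of "g s" "h e" "\<beta> t"] dist_triangle[of "g s" "\<beta> t" "g a"] by linarith
  qed
  have \<alpha>: "qg_segment q 0 (\<lambda>t. if t \<le> a + \<sigma> then \<delta> t else \<gamma> t) 0 T"
  proof (rule qg_segment_join[OF \<delta>])
    show "qg_segment q 0 \<gamma> (a + \<sigma>) T"
      using e assms(2) by (auto intro!: isometric_qg_segment simp: hd \<gamma>_def T_def)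
    show "\<delta> (a + \<sigma>) = \<gamma> (a + \<sigma>)"
      using \<sigma> by (auto simp: \<delta>_def \<beta>_def \<gamma>_def k0 simp flip: k0(2))
    fix s t assume st: "s \<in> {0..a + \<sigma>}" "t \<in> {a + \<sigma>..T}"
    define e' where "e' = t - (a + \<sigma>) + e"
    have e': "e' \<in> {e..L}" "\<gamma> t = h e'"
      using st by (auto simp: e'_def T_def \<gamma>_def)
    have ee': "dist (h e) (h e') = e' - e"
      using hd[of e e'] e' e by simp
    have ts: "t - s \<le> q * (t - s)"
      using dq[of "t - s"] st by simp
    show "(t - s) / q - 0 \<le> dist (\<delta> s) (\<gamma> t) \<and> dist (\<delta> s) (\<gamma> t) \<le> q * (t - s) + 0"
    proof (cases "s \<le> a")
      case True
      then have "(a - s) / q + \<sigma> + (e' - e) / q \<le> dist (g s) (h e')"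
        using far[of s e'] st e' by simp
      moreover have "(t - s) / q = (a - s) / q + \<sigma> / q + (e' - e) / q"
        by (simp add: e'_def add_divide_distrib diff_divide_distrib)
      moreover have "dist (g s) (g a) = a - s"
        using gd[of s a] st a True by simp
      moreover have "dist (g s) (h e') \<le> dist (g s) (g a) + \<sigma> + dist (h e) (h e')"
        using dist_triangle[of "g s" "h e'" "g a"] dist_triangle[of "g a" "h e'" "h e"] by (simp add: \<sigma>_def)
      ultimately show ?thesis
        using True e' ee' ts dq[OF \<sigma>] by (simp add: \<delta>_def e'_def)
    next
      case False
      have "\<sigma> + (e' - e) / q \<le> dist (g a) (h e')"
        using far[of a e'] a e' by simp
      moreover have "dist (\<beta> s) (h e) = a + \<sigma> - s" "dist (g a) (\<beta> s) = s - a"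
        using kd[of "s - a" \<sigma>] kd[of 0 "s - a"] st False \<sigma> by (auto simp: \<beta>_def k0)
      moreover have "(t - s) / q = (a + \<sigma> - s) / q + (e' - e) / q" "(a + \<sigma> - s) / q \<le> a + \<sigma> - s"
        using dq[of "a + \<sigma> - s"] st by (auto simp: e'_def add_divide_distrib diff_divide_distrib)
      moreover have "dist (\<beta> s) (h e') \<le> dist (\<beta> s) (h e) + dist (h e) (h e')"
        by (rule dist_triangle)
      ultimately show ?thesis
        using False e' ee' ts dist_triangle[of "g a" "h e'" "\<beta> s"] by (simp add: \<delta>_def e'_def)
    qed
  qed
  show ?thesis
  proof (rule that[OF _ _ _ \<alpha>])
    show "(if T \<le> a + \<sigma> then \<delta> T else \<gamma> T) = r"
    \<comment> \<open>If \<open>e = L\<close>, the third piece is a single point and the end is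
      reached on the bridge.\<close>
    proof (cases "e = L")
      case True
      then show ?thesis
        using \<sigma> k0 geodesic_segmentD(1,2)[OF h] by (auto simp: T_def \<delta>_def \<beta>_def L_def simp flip: k0(2))
    next
      case False
      then show ?thesis
        using e geodesic_segmentD(1,2)[OF h] by (auto simp: T_def \<gamma>_def L_def)
    qed
  qed (use a e \<sigma> short geodesic_segmentD(1,2)[OF g] in \<open>auto simp: u_def L_def T_def \<delta>_def \<sigma>_def\<close>)
qed

section \<open>Morse sets in CAT(0) spaces are contracting\<close>

text \<open>Extracts the case of the first and third sides, which meet at \<open>x\<close>. The
  third side runs towards \<open>x\<close>, so \<open>t\<close> is measured from
  \<open>z\<close>.\<close>

lemma CAT0_comparison:
  fixes x y z :: "'a::metric_space"
  assumes "CAT0 TYPE('a)"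
    and "geodesic_segment g1 x y" "geodesic_segment g2 y z" "geodesic_segment g3 z x"
    and "cmod (x' - y') = dist x y" "cmod (y' - z') = dist y z" "cmod (z' - x') = dist z x"
    and "s \<in> {0..dist x y}" "t \<in> {0..dist z x}"
  shows "dist (g1 s) (g3 t) \<le> cmod (cmp_pt x' y' (dist x y) s - cmp_pt z' x' (dist z x) t)"
proof -
  note cat = assms(1)[unfolded CAT0_def, THEN conjunct2, THEN spec, THEN spec, THEN spec, THEN spec,
      THEN spec, THEN spec, THEN spec, THEN spec, THEN spec, THEN mp, of g1 x y g2 z g3 x' y' z']
  show ?thesis
    using cat[unfolded Let_def, rule_format, of 0 2 s t] assms(2-) by simp
qed

text \<open>The last bracket is \<open>2 * dist p x * dist p y\<close> times the cosine of the
  comparison angle at \<open>p\<close>: this is the law of cosines as an upper bound, with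
  denominators cleared so that degenerate triangles are included.\<close>

lemma CAT0_hinge:
  fixes p x y :: "'a::metric_space"
  assumes "CAT0 TYPE('a)" and g: "geodesic_segment g p x" and h: "geodesic_segment h p y"
    and s: "s \<in> {0..dist p x}" and t: "t \<in> {0..dist p y}"
  shows "dist p x * dist p y * (dist (g s) (h t))\<^sup>2
    \<le> dist p x * dist p y * (s\<^sup>2 + t\<^sup>2) - s * t * ((dist p x)\<^sup>2 + (dist p y)\<^sup>2 - (dist x y)\<^sup>2)"
proof (cases "dist p x = 0 \<or> dist p y = 0")
  case True
  then show ?thesis
    using s t by auto
next
  case False
  define A C E where "A = dist p x" and "C = dist p y" and "E = dist x y"
  have pos: "0 < A" "0 < C" "0 \<le> E"
    using False by (auto simp: A_def C_def E_def)
  \<comment> \<open>The comparison triangle has \<open>p\<close> at 0 and \<open>x\<close> at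
    \<open>A\<close> on the real axis; \<open>c\<close> is the real part of the vertex for
    \<open>y\<close>, and \<open>w\<close> below is its height.\<close>
  define c where "c = (A\<^sup>2 + C\<^sup>2 - E\<^sup>2) / (2 * A)"
  have c: "2 * A * c = A\<^sup>2 + C\<^sup>2 - E\<^sup>2"
    using pos by (simp add: c_def)
  have tri: "E \<le> A + C" "A \<le> C + E" "C \<le> A + E"
    using dist_triangle3[of x y p] dist_triangle[of p x y] dist_triangle[of p y x]
    by (auto simp: A_def C_def E_def dist_commute)
  have "(A - C)\<^sup>2 \<le> E\<^sup>2" "E\<^sup>2 \<le> (A + C)\<^sup>2"
    using tri pos by (auto simp: abs_le_square_iff[symmetric])
  then have "2 * A * c \<le> 2 * A * C" "2 * A * (- C) \<le> 2 * A * c"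
    unfolding c by (auto simp: power2_eq_square algebra_simps)
  then have "c \<le> C" "- C \<le> c"
    using mult_le_cancel_left_pos[of "2 * A" c C] mult_le_cancel_left_pos[of "2 * A" "- C" c] pos by simp_all
  then have "\<bar>c\<bar> \<le> C"
    by (simp add: abs_le_iff)
  then have cC: "c\<^sup>2 \<le> C\<^sup>2"
    using pos by (metis abs_le_square_iff abs_of_pos)
  define w where "w = sqrt (C\<^sup>2 - c\<^sup>2)"
  have w: "w\<^sup>2 = C\<^sup>2 - c\<^sup>2"
    using cC by (simp add: w_def)
  define x' y' where "x' = complex_of_real A" and "y' = Complex c w"
  have "(cmod (x' - y'))\<^sup>2 = (A - c)\<^sup>2 + w\<^sup>2"
    by (simp add: x'_def y'_def cmod_power2)
  also have "\<dots> = E\<^sup>2"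
    using w c by (simp add: power2_eq_square algebra_simps)
  finally have xy': "cmod (x' - y') = E"
    using pos by (simp add: power2_eq_iff_nonneg)
  have y': "cmod y' = C"
    using pos by (simp add: y'_def cmod_def w)
  have x': "cmod x' = A"
    using pos by (simp add: x'_def)
  have "geodesic_space TYPE('a)"
    using assms(1) by (simp add: CAT0_def)
  then obtain k where k: "geodesic_segment k x y"
    by (auto simp: geodesic_space_def)
  let ?h = "\<lambda>t. h (C - t)"
  have rh: "geodesic_segment ?h y p"
    using geodesic_segment_reverse[OF h] by (simp add: C_def)
  have le: "dist (g s) (h t) \<le> cmod (cmp_pt 0 x' A s - cmp_pt y' 0 C (C - t))"
    using CAT0_comparison[OF assms(1) g k rh, of 0 x' y' s "C - t"] xy' x' y' s t
    by (simp add: A_def C_def E_def dist_commute)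
  have "cmp_pt 0 x' A s - cmp_pt y' 0 C (C - t) = of_real s - of_real (t / C) * y'"
    using pos by (simp add: cmp_pt_def x'_def field_simps)
  also have "\<dots> = Complex (s - t / C * c) (- (t / C * w))"
    by (simp add: y'_def complex_eq_iff)
  finally have "(dist (g s) (h t))\<^sup>2 \<le> (s - t / C * c)\<^sup>2 + (t / C * w)\<^sup>2"
    using power_mono[OF le, of 2] by (simp add: cmod_power2)
  also have "\<dots> = s\<^sup>2 + t\<^sup>2 - 2 * s * t * c / C"
  proof -
    have "(s - t / C * c)\<^sup>2 + (t / C * w)\<^sup>2 = s\<^sup>2 - 2 * s * t * c / C + (t / C)\<^sup>2 * (c\<^sup>2 + w\<^sup>2)"
      by (simp add: power2_eq_square algebra_simps add_divide_distrib)
    then show ?thesis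
      using pos w by (simp add: power_divide)
  qed
  finally have "A * C * (dist (g s) (h t))\<^sup>2 \<le> A * C * (s\<^sup>2 + t\<^sup>2 - 2 * s * t * c / C)"
    using pos by (intro mult_left_mono) auto
  also have "\<dots> = A * C * (s\<^sup>2 + t\<^sup>2) - s * t * (2 * A * c)"
    using pos by (simp add: field_simps)
  finally show ?thesis
    unfolding c unfolding A_def C_def E_def .
qed

definition morse_32 :: "(real \<Rightarrow> real) \<Rightarrow> 'a::metric_space \<Rightarrow> real \<Rightarrow> 'a set \<Rightarrow> bool" where
  "morse_32 \<kappa> bp M Z \<longleftrightarrow> (\<forall>\<alpha> s t. qg_segment 32 0 \<alpha> s t \<and> \<alpha> s \<in> Z \<and> \<alpha> t \<in> Z \<longrightarrow>
     \<alpha> ` {s..t} \<subseteq> kappa_nbhd \<kappa> bp Z M)"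

text \<open>The corner at \<open>g u\<close> cannot be cut off close to \<open>p\<close>, because the path through the corner is
  only slightly longer than \<open>dist p r\<close>.\<close>

lemma morse_32_corner:
  fixes bp :: "'a::metric_space"
  assumes "geodesic_space TYPE('a)" "morse_32 \<kappa> bp M Z"
    and p: "p \<in> nearest_pts x Z" and r: "r \<in> Z"
    and g: "geodesic_segment g p x" and u: "u = dist p r / 8" "u \<le> dist p x"
    and L: "dist (g u) r \<le> 11 / 10 * dist p r"
  obtains v where "dist p v \<le> dist p x" "dist p r \<le> 250 * M * \<kappa> (dist bp v)"
proof -
  have u0: "u \<in> {0..dist p x}"
    using u zero_le_dist[of p r] unfolding atLeastAtMost_iff by linarith
  have pu: "dist p (g u) = u"
    using geodesic_segment_dist[OF g u0] by simp
  have gu: "geodesic_segment g p (g u)"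
    using geodesic_segmentD[OF g] u0 by (auto simp: geodesic_segment_def pu)
  obtain h where h: "geodesic_segment h (g u) r"
    using assms(1) by (auto simp: geodesic_space_def)
  obtain a e \<alpha> T where a: "a \<in> {0..u}" and e: "e \<in> {0..dist (g u) r}"
    and short: "32 * dist (g a) (h e) \<le> u - a + e"
    and \<alpha>: "qg_segment 32 0 \<alpha> 0 T" "\<alpha> 0 = p" "\<alpha> T = r" "a \<in> {0..T}" "\<alpha> a = g a"
    by (rule geodesic_corner_shortcut[OF assms(1) _ gu h, of 32]) (use pu in auto)
  have a': "a \<in> {0..dist p x}"
    using a u0 by simp
  have "dist (g a) (g u) = u - a"
    using geodesic_segmentD(3)[OF g a' u0] a by simp
  moreover have "dist (g u) (h e) = e" "dist (h e) r = dist (g u) r - e"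
    using geodesic_segment_dist[OF h e] by auto
  moreover have "dist p (g a) = a"
    using geodesic_segment_dist[OF g a'] by simp
  \<comment> \<open>Let \<open>\<sigma>\<close> be the length of the bridge from \<open>g a\<close>
    to \<open>h e\<close>. The triangle inequality at the corner gives
    \<open>31 * \<sigma> \<le> 2 * (u - a)\<close> and \<open>u - a \<le> e + \<sigma>\<close>. The
    route over the bridge then yields \<open>dist p r \<le> 2 * a + 2 * \<sigma> + (11 / 10 - 1 / 8)
    * dist p r\<close>, where \<open>2 * \<sigma>\<close> is at most \<open>dist p r / 62\<close>,
    less than the \<open>dist p r / 40\<close> that remains on the left. Here the constants 32, 8
    and 11/10 have to fit together.\<close>
  ultimately have "dist p r \<le> 250 * a"
    using short L u(1) dist_triangle[of p r "g a"] dist_triangle[of "g a" r "h e"]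
      dist_triangle2[of "g a" "g u" "h e"] dist_triangle3[of "g u" "h e" "g a"] by linarith
  also have "a \<le> infdist (g a) Z"
    by (rule geodesic_segment_infdist[OF g p a'])
  also have "\<dots> \<le> M * \<kappa> (dist bp (g a))"
  proof -
    have "\<alpha> ` {0..T} \<subseteq> kappa_nbhd \<kappa> bp Z M"
      using assms(2) \<alpha> nearest_ptsD(1)[OF p] r by (auto simp: morse_32_def)
    then have "\<alpha> a \<in> kappa_nbhd \<kappa> bp Z M"
      using \<alpha>(4) by blast
    then show ?thesis
      using \<alpha>(5) by (simp add: kappa_nbhd_def)
  qed
  finally have "dist p r \<le> 250 * M * \<kappa> (dist bp (g a))"
    by simp
  moreover have "dist p (g a) \<le> dist p x"
    using geodesic_segment_dist[OF g a'] a' by simp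
  ultimately show ?thesis
    using that by blast
qed

lemma le_11_10:
  fixes d D :: real
  assumes "d\<^sup>2 \<le> 77 / 64 * D\<^sup>2" "0 \<le> D"
  shows "d \<le> 11 / 10 * D"
proof (rule power2_le_imp_le)
  show "d\<^sup>2 \<le> (11 / 10 * D)\<^sup>2"
  proof -
    have "(11 / 10 * D)\<^sup>2 = 121 / 100 * D\<^sup>2"
      by (simp add: power2_eq_square)
    then show ?thesis
      using assms(1) zero_le_power2[of D] by linarith
  qed
qed (use assms(2) in simp)

text \<open>The triangle \<open>p\<close>, \<open>r\<close>, \<open>y\<close> decides where the
  corner goes. If \<open>C \<le> B + 3 / 4 * D\<close>, the comparison angle at \<open>r\<close> has
  cosine at least -3/4 and the corner is put on \<open>[r, y]\<close>. Otherwise the comparison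
  angle at \<open>p\<close> between \<open>[p, y]\<close> and \<open>[p, r]\<close> has cosine at
  least 3/4, and the one between \<open>[p, x]\<close> and \<open>[p, y]\<close> is not obtuse
  because \<open>dist x y \<le> A\<close>; together they permit a corner on
  \<open>[p, x]\<close>.\<close>

lemma morse_32_imp_contracting:
  fixes bp :: "'a::metric_space"
  assumes K: "sublinear_fn \<kappa>" and cat: "CAT0 TYPE('a)" and bp: "bp \<in> Z" and M: "morse_32 \<kappa> bp M Z"
  shows "contracting_with \<kappa> bp (2000 * \<bar>M\<bar> + 1) Z"
  unfolding contracting_with_def
proof (intro allI impI ballI)
  fix x y p r
  assume xy: "dist x y \<le> infdist x Z" and p: "p \<in> nearest_pts x Z" and r: "r \<in> nearest_pts y Z"
  have geo: "geodesic_space TYPE('a)"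
    using cat by (simp add: CAT0_def)
  define A B C D where "A = dist p x" and "B = dist r y" and "C = dist p y" and "D = dist p r"
  have nn: "0 \<le> A" "0 \<le> B" "0 \<le> C" "0 \<le> D"
    by (simp_all add: A_def B_def C_def D_def)
  have pZ: "p \<in> Z" and rZ: "r \<in> Z"
    using nearest_ptsD(1)[OF p] nearest_ptsD(1)[OF r] .
  have E: "dist x y \<le> A"
    using xy nearest_ptsD(2)[OF p] by (simp add: A_def dist_commute)
  have BC: "B \<le> C"
    using nearest_ptsD(2)[OF r] infdist_le[OF pZ, of y] by (simp add: B_def C_def dist_commute)
  have C2A: "C \<le> 2 * A"
    using E dist_triangle[of p y x] by (simp add: A_def C_def)
  have DBC: "D \<le> B + C"
    using dist_triangle[of p r y] by (simp add: D_def B_def C_def dist_commute)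
  have bx: "A \<le> dist bp x" "dist bp y \<le> 2 * dist bp x" "B \<le> dist bp y"
    using dist_nearest_pts_le[OF p bp] dist_nearest_pts_le[OF r bp] E dist_triangle[of bp y x]
    by (auto simp: A_def B_def dist_commute)
  \<comment> \<open>At \<open>v\<close> the Morse bound is applied. Three doublings of the argument
    of \<open>\<kappa>\<close> cost a factor 8, whence 2000 as \<open>250 * 8\<close>.\<close>
  have "\<exists>v. dist bp v \<le> 8 * dist bp x \<and> D \<le> 250 * M * \<kappa> (dist bp v)" if "D \<noteq> 0"
  proof (cases "C \<le> B + 3 / 4 * D")
    case True
    obtain g where g: "geodesic_segment g r y"
      using geo by (auto simp: geodesic_space_def)
    obtain h where h: "geodesic_segment h r p"
      using geo by (auto simp: geodesic_space_def)
    \<comment> \<open>From \<open>D \<le> B + C \<le> 2 * B + 3 / 4 * D\<close>: there is room on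
      \<open>[r, y]\<close> for a corner at distance \<open>D / 8\<close>.\<close>
    have BD: "D / 8 \<le> B"
      using True DBC by simp
    have "0 < B * D"
      using BD nn that by auto
    have hD: "h D = p"
      using geodesic_segmentD(2)[OF h] by (simp add: D_def dist_commute)
    have "B * D * (dist (g (D / 8)) p)\<^sup>2 \<le> B * D * ((D / 8)\<^sup>2 + D\<^sup>2) - D / 8 * D * (B\<^sup>2 + D\<^sup>2 - C\<^sup>2)"
      using CAT0_hinge[OF cat g h, of "D / 8" D] BD nn hD
      by (simp add: B_def C_def D_def dist_commute)
    also have "\<dots> \<le> B * D * ((D / 8)\<^sup>2 + D\<^sup>2) - D / 8 * D * (- (3 / 2 * (B * D)))"
    proof -
      have "C\<^sup>2 \<le> (B + 3 / 4 * D)\<^sup>2"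
        using True nn by (intro power_mono) auto
      moreover have "(B + 3 / 4 * D)\<^sup>2 = B\<^sup>2 + 3 / 2 * (B * D) + 9 / 16 * D\<^sup>2"
        by (simp add: power2_eq_square algebra_simps)
      ultimately have "- (3 / 2 * (B * D)) \<le> B\<^sup>2 + D\<^sup>2 - C\<^sup>2"
        using zero_le_power2[of D] by linarith
      then have "D / 8 * D * (- (3 / 2 * (B * D))) \<le> D / 8 * D * (B\<^sup>2 + D\<^sup>2 - C\<^sup>2)"
        using nn by (intro mult_left_mono) auto
      then show ?thesis
        by linarith
    qed
    also have "\<dots> = B * D * (77 / 64 * D\<^sup>2)"
      by (simp add: power2_eq_square algebra_simps)
    finally have "dist (g (D / 8)) p \<le> 11 / 10 * D"
      using mult_le_cancel_left_pos[OF \<open>0 < B * D\<close>] nn by (intro le_11_10) blast+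
    then obtain v where v: "dist r v \<le> B" "D \<le> 250 * M * \<kappa> (dist bp v)"
      using morse_32_corner[OF geo M r pZ g, of "D / 8"] BD by (auto simp: D_def B_def dist_commute)
    have "dist bp v \<le> 8 * dist bp x"
      using v(1) bx dist_triangle[of bp v r] dist_triangle2[of bp r y] zero_le_dist[of bp x]
      unfolding B_def by linarith
    then show ?thesis
      using v(2) by blast
  next
    case False
    obtain g where g: "geodesic_segment g p x"
      using geo by (auto simp: geodesic_space_def)
    obtain h where h: "geodesic_segment h p r"
      using geo by (auto simp: geodesic_space_def)
    obtain k where k: "geodesic_segment k p y"
      using geo by (auto simp: geodesic_space_def)
    have AD: "D / 8 \<le> A" and CD: "D / 8 \<le> C"
      using DBC BC C2A False nn by auto
    have hD: "h D = r"
      using geodesic_segmentD(2)[OF h] by (simp add: D_def)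
    have "0 < A * C" "0 < C * D"
      using AD CD nn that by auto
    \<comment> \<open>The distance from the corner to \<open>r\<close> is estimated in two hops, via
      the point of \<open>[p, y]\<close> at distance \<open>D / 8\<close> from \<open>p\<close>. The
      rounded bounds 9/50 and 23/25 add up to 11/10.\<close>
    have "A * C * (dist (g (D / 8)) (k (D / 8)))\<^sup>2
        \<le> A * C * ((D / 8)\<^sup>2 + (D / 8)\<^sup>2) - D / 8 * (D / 8) * (A\<^sup>2 + C\<^sup>2 - (dist x y)\<^sup>2)"
      using CAT0_hinge[OF cat g k, of "D / 8" "D / 8"] AD CD nn by (simp add: A_def C_def)
    also have "\<dots> \<le> A * C * ((D / 8)\<^sup>2 + (D / 8)\<^sup>2) - D / 8 * (D / 8) * 0"
    proof -
      have "(dist x y)\<^sup>2 \<le> A\<^sup>2"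
        using E by (intro power_mono) auto
      then have "0 \<le> A\<^sup>2 + C\<^sup>2 - (dist x y)\<^sup>2"
        using zero_le_power2[of C] by linarith
      then show ?thesis
        using nn by (intro diff_left_mono mult_left_mono) auto
    qed
    finally have "(dist (g (D / 8)) (k (D / 8)))\<^sup>2 \<le> (D / 8)\<^sup>2 + (D / 8)\<^sup>2"
      using mult_le_cancel_left_pos[OF \<open>0 < A * C\<close>] by simp
    also have "\<dots> \<le> (9 / 50 * D)\<^sup>2"
      by (simp add: power2_eq_square algebra_simps)
    finally have 1: "dist (g (D / 8)) (k (D / 8)) \<le> 9 / 50 * D"
      using nn by (auto intro: power2_le_imp_le)
    have "C * D * (dist (k (D / 8)) r)\<^sup>2 \<le> C * D * ((D / 8)\<^sup>2 + D\<^sup>2) - D / 8 * D * (C\<^sup>2 + D\<^sup>2 - B\<^sup>2)"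
      using CAT0_hinge[OF cat k h, of "D / 8" D] CD nn hD by (simp add: B_def C_def D_def dist_commute)
    also have "\<dots> \<le> C * D * ((D / 8)\<^sup>2 + D\<^sup>2) - D / 8 * D * (3 / 2 * (C * D))"
    proof -
      have "B\<^sup>2 \<le> (C - 3 / 4 * D)\<^sup>2"
        using False nn by (intro power_mono) auto
      moreover have "(C - 3 / 4 * D)\<^sup>2 = C\<^sup>2 - 3 / 2 * (C * D) + 9 / 16 * D\<^sup>2"
        by (simp add: power2_eq_square algebra_simps)
      ultimately have "3 / 2 * (C * D) \<le> C\<^sup>2 + D\<^sup>2 - B\<^sup>2"
        using zero_le_power2[of D] by linarith
      then show ?thesis
        using nn by (intro diff_left_mono mult_left_mono) auto
    qed
    also have "\<dots> = C * D * (53 / 64 * D\<^sup>2)"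
      by (simp add: power2_eq_square algebra_simps)
    finally have "(dist (k (D / 8)) r)\<^sup>2 \<le> 53 / 64 * D\<^sup>2"
      using mult_le_cancel_left_pos[OF \<open>0 < C * D\<close>] by blast
    also have "\<dots> \<le> (23 / 25 * D)\<^sup>2"
      by (simp add: power2_eq_square algebra_simps)
    finally have 2: "dist (k (D / 8)) r \<le> 23 / 25 * D"
      using nn by (auto intro: power2_le_imp_le)
    have "dist (g (D / 8)) r \<le> 11 / 10 * D"
      using 1 2 dist_triangle[of "g (D / 8)" r "k (D / 8)"] by linarith
    then obtain v where v: "dist p v \<le> A" "D \<le> 250 * M * \<kappa> (dist bp v)"
      using morse_32_corner[OF geo M p rZ g, of "D / 8"] AD by (auto simp: D_def A_def)
    have "dist bp v \<le> 8 * dist bp x"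
      using v(1) bx dist_triangle[of bp v p] dist_triangle2[of bp p x] zero_le_dist[of bp x]
      unfolding A_def by linarith
    then show ?thesis
      using v(2) by blast
  qed
  moreover have "250 * M * \<kappa> (dist bp v) \<le> (2000 * \<bar>M\<bar> + 1) * \<kappa> (dist bp x)"
    if "dist bp v \<le> 8 * dist bp x" for v
  proof -
    have "\<kappa> (dist bp v) \<le> \<kappa> (2 * (2 * (2 * dist bp x)))"
      using that by (intro sublinear_mono[OF K]) auto
    also have "\<dots> \<le> 8 * \<kappa> (dist bp x)"
      using sublinear_double[OF K, of "2 * (2 * dist bp x)"] sublinear_double[OF K, of "2 * dist bp x"]
        sublinear_double[OF K, of "dist bp x"] by simp
    finally have "M * \<kappa> (dist bp v) \<le> \<bar>M\<bar> * (8 * \<kappa> (dist bp x))"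
      using sublinear_ge_1[OF K, of "dist bp v"] by (intro mult_mono) auto
    then show ?thesis
      using sublinear_ge_1[OF K, of "dist bp x"] by (simp add: algebra_simps)
  qed
  moreover have "0 \<le> (2000 * \<bar>M\<bar> + 1) * \<kappa> (dist bp x)"
    using sublinear_ge_1[OF K, of "dist bp x"] by simp
  ultimately show "dist p r \<le> (2000 * \<bar>M\<bar> + 1) * \<kappa> (dist bp x)"
    unfolding D_def[symmetric] by (cases "D = 0") (simp, meson order_trans)
qed

section \<open>Contracting sets\<close>

lemma qg_segment_subinterval:
  assumes "qg_segment q Q \<alpha> a b" "a \<le> s" "s \<le> t" "t \<le> b"
  shows "qg_segment q Q \<alpha> s t"
  using assms continuous_on_subset[of "{a..b}" \<alpha> "{s..t}"] unfolding qg_segment_def by auto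

text \<open>Induction over steps that each travel exactly \<open>infdist (\<alpha> s) Z\<close>, so
  that contraction applies. A step moves the projection by at most \<open>c * \<kappa>\<close>,
  which is at most \<open>c / N\<close> times the distance travelled because the path stays
  \<open>N * \<kappa>\<close> away from \<open>Z\<close>. The final incomplete step accounts for
  \<open>infdist (\<alpha> t) Z + Q\<close>.\<close>

lemma contracting_progress:
  fixes bp :: "'a::metric_space"
  assumes K: "sublinear_fn \<kappa>" and proper: "proper_space TYPE('a)" and Z: "closed Z" "Z \<noteq> {}"
    and c: "1 \<le> c" "contracting_with \<kappa> bp c Z" and qQ: "1 \<le> q" "0 \<le> Q" and N: "2 * Q < N"
    and \<alpha>: "qg_segment q Q \<alpha> s t"
    and away: "\<And>u. u \<in> {s..t} \<Longrightarrow> N * \<kappa> (dist bp (\<alpha> u)) \<le> infdist (\<alpha> u) Z"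
    and p: "p \<in> nearest_pts (\<alpha> s) Z" and r: "r \<in> nearest_pts (\<alpha> t) Z"
  shows "dist p r \<le> c / N * (2 * q * (t - s) + infdist (\<alpha> t) Z + Q)"
proof -
  \<comment> \<open>Lower bound for the parameter length of a complete step, which makes the number
    of steps finite.\<close>
  define \<delta> where "\<delta> = (N - Q) / q"
  have \<delta>: "0 < \<delta>"
    using N qQ by (simp add: \<delta>_def)
  have cN: "0 \<le> c / N"
    using N qQ c by simp
  obtain n :: nat where "(t - s) / \<delta> \<le> n"
    using real_arch_simple by blast
  then have "t - s \<le> n * \<delta>"
    using \<delta> by (simp add: pos_divide_le_eq)
  then show ?thesis
    using \<alpha> away p
  proof (induction n arbitrary: s p)
    case (0 s p)
    then have "s = t"
      by (simp add: qg_segment_def)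
    then have "dist p r \<le> c * \<kappa> (dist bp (\<alpha> s))"
      using contracting_withD[OF c(2) _ "0.prems"(4) r] by (simp add: infdist_nonneg)
    also have "\<dots> = c / N * (N * \<kappa> (dist bp (\<alpha> s)))"
      using N qQ by simp
    also have "\<dots> \<le> c / N * infdist (\<alpha> s) Z"
      using "0.prems"(3)[of s] \<open>s = t\<close> cN by (intro mult_left_mono) auto
    also have "\<dots> \<le> c / N * (2 * q * (t - s) + infdist (\<alpha> t) Z + Q)"
      using \<open>s = t\<close> cN qQ by (intro mult_left_mono) auto
    finally show ?case .
  next
    case (Suc n s p)
    have st: "s \<le> t" and cont: "continuous_on {s..t} \<alpha>"
      using Suc.prems(2) by (auto simp: qg_segment_def)
    have "c * \<kappa> (dist bp (\<alpha> s)) = c / N * (N * \<kappa> (dist bp (\<alpha> s)))"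
      using N qQ by simp
    also have "\<dots> \<le> c / N * infdist (\<alpha> s) Z"
      using Suc.prems(3)[of s] st cN by (intro mult_left_mono) auto
    finally have step: "c * \<kappa> (dist bp (\<alpha> s)) \<le> c / N * infdist (\<alpha> s) Z" .
    show ?case
    proof (cases "dist (\<alpha> s) (\<alpha> t) \<le> infdist (\<alpha> s) Z")
      case True
      have "dist p r \<le> c / N * infdist (\<alpha> s) Z"
        using contracting_withD[OF c(2) True Suc.prems(4) r] step by simp
      also have "\<dots> \<le> c / N * (2 * q * (t - s) + infdist (\<alpha> t) Z + Q)"
      proof (rule mult_left_mono[OF _ cN])
        have "infdist (\<alpha> s) Z \<le> infdist (\<alpha> t) Z + (q * (t - s) + Q)"
          using infdist_triangle[of "\<alpha> s" Z "\<alpha> t"] qg_segmentD(2)[OF Suc.prems(2), of s t] st by simp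
        moreover have "0 \<le> q * (t - s)"
          using qQ st by simp
        ultimately show "infdist (\<alpha> s) Z \<le> 2 * q * (t - s) + infdist (\<alpha> t) Z + Q"
          by simp
      qed
      finally show ?thesis .
    next
      case False
      have "\<exists>u\<ge>s. u \<le> t \<and> dist (\<alpha> s) (\<alpha> u) = infdist (\<alpha> s) Z"
        using False st cont by (intro IVT') (auto intro!: continuous_intros simp: infdist_nonneg)
      then obtain u where u: "s \<le> u" "u \<le> t" "dist (\<alpha> s) (\<alpha> u) = infdist (\<alpha> s) Z"
        by blast
      have d: "infdist (\<alpha> s) Z \<le> q * (u - s) + Q"
        using qg_segmentD(2)[OF Suc.prems(2), of s u] u by simp
      have "N * 1 \<le> N * \<kappa> (dist bp (\<alpha> s))"
        using sublinear_ge_1[OF K, of "dist bp (\<alpha> s)"] N qQ by (intro mult_left_mono) auto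
      then have "N \<le> q * (u - s) + Q"
        using Suc.prems(3)[of s] st d by simp
      \<comment> \<open>As \<open>N - Q > Q\<close>, the additive error is absorbed into
        \<open>q * (u - s)\<close>; hence the factor 2 in the bound.\<close>
      then have "\<delta> \<le> u - s" and Q: "Q \<le> q * (u - s)"
        using qQ N by (auto simp: \<delta>_def pos_divide_le_eq mult.commute)
      then have n: "t - u \<le> n * \<delta>"
        using Suc.prems(1) by (simp add: algebra_simps)
      obtain p' where p': "p' \<in> nearest_pts (\<alpha> u) Z"
        using nearest_pts_nonempty[OF proper Z] .
      have "dist p' r \<le> c / N * (2 * q * (t - u) + infdist (\<alpha> t) Z + Q)"
        using Suc.prems(3) u by (intro Suc.IH[OF n qg_segment_subinterval[OF Suc.prems(2)] _ p']) auto
      moreover have "dist p p' \<le> c / N * infdist (\<alpha> s) Z"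
        using contracting_withD[OF c(2) _ Suc.prems(4) p'] u(3) step by simp
      moreover have "c / N * infdist (\<alpha> s) Z \<le> c / N * (2 * q * (u - s))"
        using d Q by (intro mult_left_mono[OF _ cN]) simp
      moreover have "c / N * (2 * q * (u - s)) + c / N * (2 * q * (t - u) + infdist (\<alpha> t) Z + Q)
          = c / N * (2 * q * (t - s) + infdist (\<alpha> t) Z + Q)"
        by (simp add: add_divide_distrib diff_divide_distrib algebra_simps)
      ultimately show ?thesis
        using dist_triangle[of p r p'] by linarith
    qed
  qed
qed

text \<open>The set of parameters where \<open>P\<close> holds need not be closed, so the last one is only
  approximated.\<close>

lemma coarse_last_exit:
  fixes a \<tau> :: real
  assumes "P a" "\<not> P \<tau>" "a \<le> \<tau>"
  obtains s0 s where "a \<le> s0" "s0 \<le> s" "s \<le> s0 + 1" "s \<le> \<tau>" "P s0" "\<And>u. u \<in> {s..\<tau>} \<Longrightarrow> \<not> P u"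
proof -
  define S where "S = {u \<in> {a..\<tau>}. P u}"
  define \<sigma> where "\<sigma> = Sup S"
  have aS: "a \<in> S" and bdd: "bdd_above S"
    using assms by (auto simp: S_def)
  have up: "u \<le> \<sigma>" if "u \<in> S" for u
    unfolding \<sigma>_def by (rule cSup_upper[OF that bdd])
  have \<sigma>\<tau>: "\<sigma> \<le> \<tau>"
    unfolding \<sigma>_def using aS by (intro cSup_least) (auto simp: S_def)
  obtain s0 where s0: "s0 \<in> S" "\<sigma> - 1 / 2 < s0"
    using less_cSupD[of S "\<sigma> - 1 / 2"] aS by (auto simp: \<sigma>_def)
  \<comment> \<open>Half a unit past the supremum \<open>P\<close> fails up to
    \<open>\<tau>\<close>, and \<open>s0\<close> is less than half a unit before it. If the minimum
    is \<open>\<tau>\<close>, the assumption at \<open>\<tau>\<close> takes over.\<close>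
  define s where "s = min (\<sigma> + 1 / 2) \<tau>"
  have "\<not> P u" if u: "u \<in> {s..\<tau>}" for u
  proof
    assume "P u"
    moreover have "a \<le> u"
      using u up[OF aS] assms(3) by (auto simp: s_def)
    ultimately have "u \<le> \<sigma>"
      using u by (intro up) (simp add: S_def)
    then have "u = \<tau>"
      using u by (auto simp: s_def)
    then show False
      using \<open>P u\<close> assms(2) by simp
  qed
  moreover have "s0 \<le> s" "s \<le> s0 + 1" "s \<le> \<tau>"
    using s0 up[OF s0(1)] \<sigma>\<tau> by (auto simp: s_def)
  ultimately show ?thesis
    using that[of s0 s] s0(1) by (auto simp: S_def)
qed

text \<open>While the path is far from \<open>Z\<close>, its projection moves slowly, so an excursion away from \<open>Z\<close>
  has length comparable to \<open>\<kappa>\<close> at one of its two ends.\<close>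

lemma contracting_imp_morse:
  fixes bp :: "'a::metric_space"
  assumes K: "sublinear_fn \<kappa>" and proper: "proper_space TYPE('a)"
    and Z: "kappa_contracting \<kappa> bp Z"
  shows "kappa_morse \<kappa> bp Z"
proof (cases "Z = {}")
  case True
  then show ?thesis
    by (simp add: kappa_morse_def)
next
  case ne: False
  obtain c where cl: "closed Z" and c: "1 \<le> c" "contracting_with \<kappa> bp c Z"
    using Z kappa_contracting_iff[OF K proper ne] by blast
  have \<kappa>1: "1 \<le> \<kappa> (dist bp x)" for x
    by (rule sublinear_ge_1[OF K]) simp
  have "\<exists>m. \<forall>\<alpha> a b. qg_segment q Q \<alpha> a b \<and> \<alpha> a \<in> Z \<and> \<alpha> b \<in> Z \<longrightarrow>
      \<alpha> ` {a..b} \<subseteq> kappa_nbhd \<kappa> bp Z m" if qQ: "1 \<le> q" "0 \<le> Q" for q Q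
  proof -
    \<comment> \<open>With this threshold the projection advances by at most
      \<open>(t - s) / (2 * q)\<close> up to additive terms, half of the growth
      \<open>(t - s) / q\<close> of a quasi-geodesic. The other half then bounds
      \<open>t - s\<close>.\<close>
    define N where "N = 4 * c * q\<^sup>2 + 2 * Q"
    have q2: "1 \<le> q\<^sup>2"
      using qQ(1) by simp
    have q4: "1 / (4 * q\<^sup>2) \<le> 1"
      using q2 by (intro divide_le_eq_1_pos[THEN iffD2]) linarith+
    have "1 \<le> c * q\<^sup>2"
      using mult_mono[OF c(1) q2] c(1) by simp
    then have N: "2 * Q < N" "0 < N"
      using qQ by (auto simp: N_def)
    have cN: "0 \<le> c / N" "c / N \<le> 1 / (4 * q\<^sup>2)"
      using c(1) N qQ by (auto simp: N_def field_simps)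
    obtain K0 where K0: "1 \<le> K0" "\<And>x y bp::'a. dist x y \<le> (q + Q) * \<kappa> (dist bp x) \<Longrightarrow>
       \<kappa> (dist bp y) \<le> K0 * \<kappa> (dist bp x) \<and> \<kappa> (dist bp x) \<le> K0 * \<kappa> (dist bp y)"
      using sublinear_comparable[OF K, where C="q + Q" and 'a='a] by blast
    define N1 where "N1 = N * K0 + q + Q"
    define C1 where "C1 = q * (2 * q * (2 * Q + 3 * N1)) + Q"
    obtain K1 where K1: "1 \<le> K1" "\<And>x y bp::'a. dist x y \<le> C1 * \<kappa> (dist bp x) \<Longrightarrow>
       \<kappa> (dist bp y) \<le> K1 * \<kappa> (dist bp x) \<and> \<kappa> (dist bp x) \<le> K1 * \<kappa> (dist bp y)"
      using sublinear_comparable[OF K, where C=C1 and 'a='a] by blast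
    have N1: "0 \<le> N1"
      using N K0(1) qQ by (simp add: N1_def)
    have C1: "0 \<le> C1"
      using N1 qQ by (simp add: C1_def)
    \<comment> \<open>The threshold \<open>N\<close> is met only within one parameter unit of the
      ends of an excursion; \<open>N1\<close> is what it becomes at the ends themselves.\<close>
    have near_end: "infdist y Z \<le> N1 * \<kappa> (dist bp y)"
      if "infdist x Z \<le> N * \<kappa> (dist bp x)" "dist x y \<le> q + Q" for x y
    proof -
      have "(q + Q) * 1 \<le> (q + Q) * \<kappa> (dist bp y)"
        using qQ \<kappa>1 by (intro mult_left_mono) auto
      then have qy: "dist y x \<le> (q + Q) * \<kappa> (dist bp y)"
        using that(2) by (simp add: dist_commute)
      have "N * \<kappa> (dist bp x) \<le> N * (K0 * \<kappa> (dist bp y))"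
        using K0(2)[OF qy] N(2) by (intro mult_left_mono) auto
      then show ?thesis
        using that(1) qy infdist_triangle[of y Z x] by (simp add: N1_def algebra_simps)
    qed
    have excursion: "infdist (\<alpha> \<tau>) Z \<le> (C1 + N1) * K1 * \<kappa> (dist bp (\<alpha> \<tau>))"
      if \<alpha>: "qg_segment q Q \<alpha> s t" and \<tau>: "s \<le> \<tau>" "\<tau> \<le> t"
        and away: "\<And>u. u \<in> {s..t} \<Longrightarrow> N * \<kappa> (dist bp (\<alpha> u)) \<le> infdist (\<alpha> u) Z"
        and ends: "infdist (\<alpha> s) Z \<le> N1 * \<kappa> (dist bp (\<alpha> s))" "infdist (\<alpha> t) Z \<le> N1 * \<kappa> (dist bp (\<alpha> t))"
      for \<alpha> s t \<tau>
    proof -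
      obtain p where p: "p \<in> nearest_pts (\<alpha> s) Z"
        using nearest_pts_nonempty[OF proper cl ne] .
      obtain r where r: "r \<in> nearest_pts (\<alpha> t) Z"
        using nearest_pts_nonempty[OF proper cl ne] .
      define \<mu> where "\<mu> = max (\<kappa> (dist bp (\<alpha> s))) (\<kappa> (dist bp (\<alpha> t)))"
      have \<mu>: "1 \<le> \<mu>"
        using \<kappa>1 by (simp add: \<mu>_def le_max_iff_disj)
      have st: "s \<le> t"
        using \<tau> by simp
      have "infdist (\<alpha> s) Z \<le> N1 * \<mu>" "infdist (\<alpha> t) Z \<le> N1 * \<mu>"
        using ends mult_left_mono[OF _ N1, of "\<kappa> (dist bp (\<alpha> s))" \<mu>]
          mult_left_mono[OF _ N1, of "\<kappa> (dist bp (\<alpha> t))" \<mu>] by (auto simp: \<mu>_def)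
      moreover have "dist p r \<le> (t - s) / (2 * q) + infdist (\<alpha> t) Z + Q"
      proof -
        have "dist p r \<le> c / N * (2 * q * (t - s) + infdist (\<alpha> t) Z + Q)"
          by (rule contracting_progress[OF K proper cl ne c qQ N(1) \<alpha> away p r])
        also have "\<dots> \<le> 1 / (4 * q\<^sup>2) * (2 * q * (t - s) + infdist (\<alpha> t) Z + Q)"
          using cN(2) qQ st by (intro mult_right_mono) (auto simp: infdist_nonneg)
        also have "\<dots> = (t - s) / (2 * q) + 1 / (4 * q\<^sup>2) * (infdist (\<alpha> t) Z + Q)"
          using qQ by (simp add: field_simps power2_eq_square)
        also have "\<dots> \<le> (t - s) / (2 * q) + 1 * (infdist (\<alpha> t) Z + Q)"
          using qQ q4 by (intro add_left_mono mult_right_mono) (auto simp: infdist_nonneg)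
        finally show ?thesis
          by simp
      qed
      moreover have "(t - s) / q - Q \<le> dist (\<alpha> s) (\<alpha> t)"
        using qg_segmentD(1)[OF \<alpha>, of s t] st by simp
      moreover have "dist (\<alpha> s) (\<alpha> t) \<le> infdist (\<alpha> s) Z + dist p r + infdist (\<alpha> t) Z"
        using dist_triangle[of "\<alpha> s" "\<alpha> t" p] dist_triangle[of p "\<alpha> t" r] nearest_ptsD(2)[OF p] nearest_ptsD(2)[OF r]
        by (simp add: dist_commute)
      moreover have "(t - s) / q = (t - s) / (2 * q) + (t - s) / (2 * q)"
        by simp
      moreover have "Q * 1 \<le> Q * \<mu>"
        using \<mu> qQ by (intro mult_left_mono)
      moreover have "(2 * Q + 3 * N1) * \<mu> = 2 * (Q * \<mu>) + 3 * (N1 * \<mu>)"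
        by (simp add: distrib_right)
      ultimately have "(t - s) / (2 * q) \<le> (2 * Q + 3 * N1) * \<mu>"
        by linarith
      then have "t - s \<le> (2 * Q + 3 * N1) * \<mu> * (2 * q)"
        using qQ by (subst (asm) pos_divide_le_eq) auto
      then have ts: "t - s \<le> 2 * q * (2 * Q + 3 * N1) * \<mu>"
        by (simp only: mult_ac)
      have near: "dist (\<alpha> s) (\<alpha> \<tau>) \<le> C1 * \<mu>" "dist (\<alpha> \<tau>) (\<alpha> t) \<le> C1 * \<mu>"
      proof -
        have "q * (t - s) + Q \<le> q * (2 * q * (2 * Q + 3 * N1) * \<mu>) + Q * \<mu>"
          using ts qQ \<open>Q * 1 \<le> Q * \<mu>\<close> by (intro add_mono mult_left_mono) auto
        also have "\<dots> = C1 * \<mu>"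
          by (simp add: C1_def algebra_simps)
        finally have 1: "q * (t - s) + Q \<le> C1 * \<mu>" .
        have "q * (\<tau> - s) \<le> q * (t - s)" "q * (t - \<tau>) \<le> q * (t - s)"
          using \<tau> qQ by auto
        then show "dist (\<alpha> s) (\<alpha> \<tau>) \<le> C1 * \<mu>" "dist (\<alpha> \<tau>) (\<alpha> t) \<le> C1 * \<mu>"
          using 1 qg_segmentD(2)[OF \<alpha>, of s \<tau>] qg_segmentD(2)[OF \<alpha>, of \<tau> t] \<tau> by auto
      qed
      \<comment> \<open>The end with the larger value of \<open>\<kappa>\<close> serves as
        reference, since the excursion has size at most \<open>C1 * \<mu>\<close>; \<open>K1\<close>
        then passes from \<open>\<kappa>\<close> at \<open>e\<close> to \<open>\<kappa>\<close> at
        \<open>\<alpha> \<tau>\<close>.\<close>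
      obtain e where e: "dist e (\<alpha> \<tau>) \<le> C1 * \<kappa> (dist bp e)" "infdist e Z \<le> N1 * \<kappa> (dist bp e)"
      proof (cases "\<mu> = \<kappa> (dist bp (\<alpha> s))")
        case True
        then show ?thesis
          using that[of "\<alpha> s"] near ends by simp
      next
        case False
        then have "\<mu> = \<kappa> (dist bp (\<alpha> t))"
          by (auto simp: \<mu>_def max_def split: if_splits)
        then show ?thesis
          using that[of "\<alpha> t"] near ends by (simp add: dist_commute)
      qed
      have "infdist (\<alpha> \<tau>) Z \<le> (C1 + N1) * \<kappa> (dist bp e)"
        using infdist_triangle[of "\<alpha> \<tau>" Z e] e by (simp add: dist_commute distrib_right)
      also have "\<dots> \<le> (C1 + N1) * (K1 * \<kappa> (dist bp (\<alpha> \<tau>)))"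
        using K1(2)[OF e(1)] N1 C1 by (intro mult_left_mono) auto
      finally show ?thesis
        by simp
    qed
    define m where "m = max N ((C1 + N1) * K1)"
    have "infdist (\<alpha> \<tau>) Z \<le> m * \<kappa> (dist bp (\<alpha> \<tau>))"
      if \<alpha>: "qg_segment q Q \<alpha> a b" and ab: "\<alpha> a \<in> Z" "\<alpha> b \<in> Z" and \<tau>: "\<tau> \<in> {a..b}" for \<alpha> a b \<tau>
    proof -
      let ?P = "\<lambda>u. infdist (\<alpha> u) Z \<le> N * \<kappa> (dist bp (\<alpha> u))"
      have m: "N * \<kappa> (dist bp (\<alpha> \<tau>)) \<le> m * \<kappa> (dist bp (\<alpha> \<tau>))"
          "(C1 + N1) * K1 * \<kappa> (dist bp (\<alpha> \<tau>)) \<le> m * \<kappa> (dist bp (\<alpha> \<tau>))"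
        using \<kappa>1[of "\<alpha> \<tau>"] by (auto simp: m_def intro!: mult_right_mono)
      show ?thesis
      proof (cases "?P \<tau>")
        case True
        then show ?thesis
          using m by simp
      next
        case False
        have Pab: "?P a" "?P b"
          using ab N(2) \<kappa>1 by (auto intro!: mult_nonneg_nonneg intro: order_trans[OF zero_le_one])
        obtain s0 s where s: "a \<le> s0" "s0 \<le> s" "s \<le> s0 + 1" "s \<le> \<tau>" "?P s0"
          "\<And>u. u \<in> {s..\<tau>} \<Longrightarrow> \<not> ?P u"
          using coarse_last_exit[of ?P a \<tau>] Pab False \<tau> by auto
        \<comment> \<open>The return after \<open>\<tau>\<close> is a last exit for the reversed
          parameter, so the excursion takes place over \<open>[s, - t]\<close>.\<close>
        obtain t0 t where t: "- b \<le> t0" "t0 \<le> t" "t \<le> t0 + 1" "t \<le> - \<tau>" "?P (- t0)"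
          "\<And>u. u \<in> {t..- \<tau>} \<Longrightarrow> \<not> ?P (- u)"
          using coarse_last_exit[of "\<lambda>u. ?P (- u)" "- b" "- \<tau>"] Pab False \<tau> by auto
        have away: "N * \<kappa> (dist bp (\<alpha> u)) \<le> infdist (\<alpha> u) Z" if "u \<in> {s..- t}" for u
        proof (cases "u \<le> \<tau>")
          case True
          then show ?thesis
            using s(6)[of u] that by simp
        next
          case False
          then show ?thesis
            using t(6)[of "- u"] that by simp
        qed
        have q1: "q * d \<le> q" if "d \<le> 1" for d
          using that qQ mult_left_mono[of d 1 q] by simp
        have "dist (\<alpha> s0) (\<alpha> s) \<le> q + Q"
          using qg_segmentD(2)[OF \<alpha>, of s0 s] q1[of "s - s0"] s \<tau> by simp
        moreover have "dist (\<alpha> (- t0)) (\<alpha> (- t)) \<le> q + Q"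
          using qg_segmentD(2)[OF \<alpha>, of "- t" "- t0"] q1[of "- t0 - - t"] t \<tau> by (simp add: dist_commute)
        moreover have "qg_segment q Q \<alpha> s (- t)"
          using s t \<tau> by (intro qg_segment_subinterval[OF \<alpha>]) auto
        ultimately have "infdist (\<alpha> \<tau>) Z \<le> (C1 + N1) * K1 * \<kappa> (dist bp (\<alpha> \<tau>))"
          using s t by (intro excursion[of \<alpha> s "- t"] away near_end) auto
        then show ?thesis
          using m by simp
      qed
    qed
    then show ?thesis
      by (intro exI[of _ m]) (auto simp: kappa_nbhd_def)
  qed
  then show ?thesis
    using cl unfolding kappa_morse_def by metis
qed

section \<open>Stability of contraction under sublinear perturbation\<close>

text \<open>The geodesic from \<open>x\<close> to \<open>y\<close> is cut at the point
  \<open>z\<close> where contraction from \<open>x\<close> ceases to apply. The rest has length at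
  most \<open>R\<close>: either contraction applies from \<open>z\<close>, where
  \<open>\<kappa>\<close> has at most doubled, or \<open>z\<close> is within \<open>R\<close> of
  \<open>Z\<close> and the triangle inequality gives \<open>4 * R\<close>.\<close>

lemma contracting_coarse:
  fixes bp :: "'a::metric_space"
  assumes K: "sublinear_fn \<kappa>" and proper: "proper_space TYPE('a)" and geo: "geodesic_space TYPE('a)"
    and Z: "closed Z" "bp \<in> Z" and c: "1 \<le> c" "contracting_with \<kappa> bp c Z"
    and p: "p \<in> nearest_pts x Z" and r: "r \<in> nearest_pts y Z"
    and R: "0 \<le> R" "dist x y \<le> infdist x Z + R"
  shows "dist p r \<le> 3 * c * \<kappa> (dist bp x) + 4 * R"
proof -
  have c\<kappa>: "0 \<le> c * \<kappa> (dist bp x)"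
    using c(1) sublinear_ge_1[OF K, of "dist bp x"] by simp
  define A where "A = infdist x Z"
  have A: "0 \<le> A" "A \<le> dist bp x"
    using infdist_le[OF Z(2), of x] by (auto simp: A_def infdist_nonneg dist_commute)
  show ?thesis
  proof (cases "dist x y \<le> A")
    case True
    then have "dist p r \<le> c * \<kappa> (dist bp x)"
      using contracting_withD[OF c(2) _ p r] by (simp add: A_def)
    then show ?thesis
      using R(1) c\<kappa> by simp
  next
    case False
    obtain g where g: "geodesic_segment g x y"
      using geo by (auto simp: geodesic_space_def)
    define z where "z = g A"
    have z: "dist x z = A" "dist z y \<le> R"
      using geodesic_segment_dist[OF g, of A] False A R(2) by (auto simp: z_def A_def)
    obtain w where w: "w \<in> nearest_pts z Z"
      using nearest_pts_nonempty[OF proper Z(1)] Z(2) by blast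
    have "dist p w \<le> c * \<kappa> (dist bp x)"
      using contracting_withD[OF c(2) _ p w] z by (simp add: A_def)
    moreover have "dist w r \<le> 2 * (c * \<kappa> (dist bp x)) + 4 * R"
    proof (cases "dist z y \<le> infdist z Z")
      case True
      have "\<kappa> (dist bp z) \<le> \<kappa> (2 * dist bp x)"
        using z(1) A dist_triangle[of bp z x] by (intro sublinear_mono[OF K]) auto
      also have "\<dots> \<le> 2 * \<kappa> (dist bp x)"
        by (rule sublinear_double[OF K]) simp
      finally have "c * \<kappa> (dist bp z) \<le> c * (2 * \<kappa> (dist bp x))"
        using c(1) by (intro mult_left_mono) auto
      then show ?thesis
        using contracting_withD[OF c(2) True w r] R(1) by simp
    next
      case False
      have "dist w r \<le> dist z w + dist z y + dist y r"
        using dist_triangle3[of w r z] dist_triangle[of z r y] by simp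
      also have "\<dots> = infdist z Z + dist z y + infdist y Z"
        using nearest_ptsD(2)[OF w] nearest_ptsD(2)[OF r] by simp
      also have "\<dots> \<le> 4 * R"
        using False z(2) infdist_triangle[of y Z z] by (simp add: dist_commute)
      finally show ?thesis
        using c\<kappa> by simp
    qed
    ultimately show ?thesis
      using dist_triangle[of p r w] by simp
  qed
qed

lemma contracting_transfer:
  fixes bp :: "'a::metric_space"
  assumes K: "sublinear_fn \<kappa>" and proper: "proper_space TYPE('a)" and geo: "geodesic_space TYPE('a)"
    and Z: "kappa_contracting \<kappa> bp Z" and Y: "closed Y" and bp: "bp \<in> Z" "bp \<in> Y"
    and ZY: "Z \<subseteq> kappa_nbhd \<kappa> bp Y n" and YZ: "Y \<subseteq> kappa_nbhd \<kappa> bp Z m"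
  shows "kappa_contracting \<kappa> bp Y"
proof -
  have neZ: "Z \<noteq> {}" and neY: "Y \<noteq> {}"
    using bp by auto
  obtain c where cl: "closed Z" and c: "1 \<le> c" "contracting_with \<kappa> bp c Z"
    using Z kappa_contracting_iff[OF K proper neZ] by blast
  note coarse = contracting_coarse[OF K proper geo cl bp(1) c]
  have \<kappa>1: "1 \<le> \<kappa> (dist bp x)" for x
    by (rule sublinear_ge_1[OF K]) simp
  define N where "N = \<bar>n\<bar> + \<bar>m\<bar> + 1"
  have N: "1 \<le> N" "n + 1 \<le> N" "m + 1 \<le> N"
    by (auto simp: N_def)
  have double: "\<kappa> (dist bp y) \<le> 2 * \<kappa> (dist bp x)" if "dist bp y \<le> 2 * dist bp x" for x y
    using sublinear_mono[OF K _ that] sublinear_double[OF K, of "dist bp x"] by simp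
  have double': "\<kappa> (dist bp y) \<le> 2 * \<kappa> (dist bp x)" if "dist x y \<le> dist bp x" for x y
    using that dist_triangle[of bp y x] by (intro double) simp
  \<comment> \<open>Both sets contain \<open>bp\<close>, so a nearest point \<open>z\<close> of
    \<open>x\<close> satisfies \<open>dist x z \<le> dist bp x\<close>. Hence
    \<open>\<kappa>\<close> at most doubles from \<open>x\<close> to \<open>z\<close>, and all
    bounds can be stated at \<open>x\<close>.\<close>
  have switch: "\<exists>y\<in>Y'. dist z y \<le> 2 * N * \<kappa> (dist bp x)"
    if k: "k + 1 \<le> N" and Y': "Y' \<noteq> {}" "z \<in> kappa_nbhd \<kappa> bp Y' k" and xz: "dist x z \<le> dist bp x" for x z Y' k
  proof -
    obtain y where y: "y \<in> Y'" "dist z y \<le> (k + 1) * \<kappa> (dist bp z)"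
      using kappa_nbhd_obtain[OF K Y'(2,1)] by blast
    have "(k + 1) * \<kappa> (dist bp z) \<le> N * (2 * \<kappa> (dist bp x))"
      using k N(1) double'[OF xz] order_trans[OF zero_le_one \<kappa>1[of z]] by (intro mult_mono) auto
    then show ?thesis
      using y by (intro bexI[of _ y]) auto
  qed
  have compare: "infdist x Y \<le> infdist x Z + 2 * N * \<kappa> (dist bp x)" for x
  proof -
    obtain w where w: "w \<in> nearest_pts x Z"
      using nearest_pts_nonempty[OF proper cl neZ] .
    obtain y where y: "y \<in> Y" "dist w y \<le> 2 * N * \<kappa> (dist bp x)"
      using switch[OF N(2) neY _ dist_nearest_pts_le[OF w bp(1)]] nearest_ptsD(1)[OF w] ZY by blast
    then show ?thesis
      using infdist_le[OF y(1), of x] dist_triangle[of x y w] nearest_ptsD(2)[OF w] by simp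
  qed
  define C where "C = 3 * c + 18 * N"
  \<comment> \<open>A point \<open>q\<close> of \<open>Z\<close> near \<open>p\<close> almost
    realises the distance from \<open>x\<close> to \<open>Z\<close> and is its own nearest point, so
    the coarse estimate with \<open>y = q\<close> places it near \<open>w\<close>. This costs
    \<open>3 * c + 16 * N\<close>, and passing from \<open>q\<close> to \<open>p\<close> another
    \<open>2 * N\<close>.\<close>
  have close: "dist w p \<le> C * \<kappa> (dist bp x)"
    if p: "p \<in> nearest_pts x Y" and w: "w \<in> nearest_pts x Z" for p w x
  proof -
    obtain q where q: "q \<in> Z" "dist p q \<le> 2 * N * \<kappa> (dist bp x)"
      using switch[OF N(3) neZ _ dist_nearest_pts_le[OF p bp(2)]] nearest_ptsD(1)[OF p] YZ by blast
    have qq: "q \<in> nearest_pts q Z"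
      using q(1) by (simp add: nearest_pts_def)
    have "dist x q \<le> infdist x Z + 4 * N * \<kappa> (dist bp x)"
      using dist_triangle[of x q p] nearest_ptsD(2)[OF p] compare[of x] q(2) by simp
    then have "dist w q \<le> 3 * c * \<kappa> (dist bp x) + 4 * (4 * N * \<kappa> (dist bp x))"
      using N(1) \<kappa>1[of x] by (intro coarse[OF w qq]) auto
    then show ?thesis
      using q(2) dist_triangle2[of w p q] by (simp add: C_def algebra_simps)
  qed
  have "dist p r \<le> (3 * C + 3 * c + 8 * N) * \<kappa> (dist bp x)"
    if xy: "dist x y \<le> infdist x Y" and p: "p \<in> nearest_pts x Y" and r: "r \<in> nearest_pts y Y" for x y p r
  proof -
    obtain w where w: "w \<in> nearest_pts x Z"
      using nearest_pts_nonempty[OF proper cl neZ] .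
    obtain v where v: "v \<in> nearest_pts y Z"
      using nearest_pts_nonempty[OF proper cl neZ] .
    have "dist x y \<le> infdist x Z + 2 * N * \<kappa> (dist bp x)"
      using xy compare[of x] by simp
    then have "dist w v \<le> 3 * c * \<kappa> (dist bp x) + 4 * (2 * N * \<kappa> (dist bp x))"
      using N(1) \<kappa>1[of x] by (intro coarse[OF w v]) auto
    moreover have "dist x y \<le> dist bp x"
      using xy infdist_le[OF bp(2), of x] by (simp add: dist_commute)
    then have "C * \<kappa> (dist bp y) \<le> C * (2 * \<kappa> (dist bp x))"
      using c(1) N(1) by (intro mult_left_mono double') (auto simp: C_def)
    ultimately show ?thesis
      using close[OF p w] close[OF r v] dist_triangle3[of p r w] dist_triangle[of w r v]
      by (simp add: algebra_simps)
  qed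
  then have "contracting_with \<kappa> bp (3 * C + 3 * c + 8 * N) Y"
    by (auto simp: contracting_with_def)
  moreover have "1 \<le> 3 * C + 3 * c + 8 * N"
    using c(1) N(1) by (simp add: C_def)
  ultimately show ?thesis
    using kappa_contracting_iff[OF K proper neY] Y by blast
qed

section \<open>Quasi-geodesic rays\<close>

lemma qg_ray_withD:
  assumes "qg_ray_with bp q Q \<beta>"
  shows "\<beta> 0 = bp" "continuous_on {0..} \<beta>"
    "0 \<le> s \<Longrightarrow> s \<le> t \<Longrightarrow> (t - s) / q - Q \<le> dist (\<beta> s) (\<beta> t)"
    "0 \<le> s \<Longrightarrow> s \<le> t \<Longrightarrow> dist (\<beta> s) (\<beta> t) \<le> q * (t - s) + Q"
proof -
  show "\<beta> 0 = bp" "continuous_on {0..} \<beta>"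
    using assms by (auto simp: qg_ray_with_def)
  assume "0 \<le> s" "s \<le> t"
  then have "\<bar>s - t\<bar> / q - Q \<le> dist (\<beta> s) (\<beta> t) \<and> dist (\<beta> s) (\<beta> t) \<le> q * \<bar>s - t\<bar> + Q"
    using assms order_trans[of 0 s t] unfolding qg_ray_with_def by blast
  then show "(t - s) / q - Q \<le> dist (\<beta> s) (\<beta> t)" "dist (\<beta> s) (\<beta> t) \<le> q * (t - s) + Q"
    using \<open>s \<le> t\<close> by (simp_all add: abs_minus_commute)
qed

lemma geodesic_ray_qg_ray:
  assumes "geodesic_ray bp b"
  shows "qg_ray_with bp 1 0 b"
  using assms isometric_continuous_on[of "{0..}" b] by (auto simp: geodesic_ray_def qg_ray_with_def)

lemma base_in_ray_image: "qg_ray bp \<beta> \<Longrightarrow> bp \<in> ray_image \<beta>"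
  by (force simp: qg_ray_def qg_ray_with_def ray_image_def)

text \<open>By the lower quasi-geodesic bound, a bounded sequence on the ray stays in the image of a
  compact initial parameter interval.\<close>

lemma closed_ray_image:
  fixes bp :: "'a::metric_space"
  assumes "qg_ray bp \<beta>"
  shows "closed (ray_image \<beta>)"
  unfolding closed_sequential_limits
proof (intro allI impI, elim conjE)
  fix x l assume x: "\<forall>n. x n \<in> ray_image \<beta>" "x \<longlonglongrightarrow> l"
  obtain q Q where q: "1 \<le> q" "0 \<le> Q" and \<beta>: "qg_ray_with bp q Q \<beta>"
    using assms by (auto simp: qg_ray_def)
  have "bounded (range x)"
    using x(2) by (rule convergent_imp_bounded)
  then obtain R where R: "\<And>n. dist bp (x n) \<le> R"
    unfolding bounded_any_center[of _ bp] by auto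
  define T where "T = q * (R + Q)"
  have "x n \<in> \<beta> ` {0..T}" for n
  proof -
    obtain t where t: "0 \<le> t" "x n = \<beta> t"
      using x(1) by (auto simp: ray_image_def)
    have "t / q - Q \<le> R"
      using qg_ray_withD(1)[OF \<beta>] qg_ray_withD(3)[OF \<beta>, of 0 t] R[of n] t by simp
    then have "t \<le> T"
      using q by (simp add: T_def pos_divide_le_eq mult.commute algebra_simps)
    then show ?thesis
      using t by auto
  qed
  moreover have "compact (\<beta> ` {0..T})"
    using qg_ray_withD(2)[OF \<beta>] by (intro compact_continuous_image) (auto elim: continuous_on_subset)
  then have "closed (\<beta> ` {0..T})"
    by (rule compact_imp_closed)
  ultimately have "l \<in> \<beta> ` {0..T}"
    using x(2) closed_sequentially[of "\<beta> ` {0..T}" x l] by blast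
  then show "l \<in> ray_image \<beta>"
    by (auto simp: ray_image_def)
qed

text \<open>Parameters on \<open>\<beta>\<close> close to the points \<open>\<gamma> 0, \<gamma> 1, \<dots>\<close> start at 0, tend to infinity and have
  gaps of size comparable to \<open>\<kappa>\<close>.\<close>

lemma qg_ray_nbhd_sym:
  fixes bp :: "'a::metric_space"
  assumes K: "sublinear_fn \<kappa>" and "qg_ray bp \<beta>" "qg_ray bp \<gamma>"
    and sub: "ray_image \<gamma> \<subseteq> kappa_nbhd \<kappa> bp (ray_image \<beta>) n"
  obtains m where "ray_image \<beta> \<subseteq> kappa_nbhd \<kappa> bp (ray_image \<gamma>) m"
proof -
  obtain q Q where q: "1 \<le> q" "0 \<le> Q" and \<beta>: "qg_ray_with bp q Q \<beta>"
    using assms by (auto simp: qg_ray_def)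
  obtain q' Q' where q': "1 \<le> q'" "0 \<le> Q'" and \<gamma>: "qg_ray_with bp q' Q' \<gamma>"
    using assms by (auto simp: qg_ray_def)
  have \<kappa>1: "1 \<le> \<kappa> (dist bp x)" for x
    by (rule sublinear_ge_1[OF K]) simp
  define N where "N = \<bar>n\<bar> + 1"
  have N: "1 \<le> N"
    by (simp add: N_def)
  have "\<exists>s\<ge>0. dist (\<gamma> (real i)) (\<beta> s) \<le> N * \<kappa> (dist bp (\<gamma> (real i)))" for i
  proof -
    have "\<gamma> (real i) \<in> kappa_nbhd \<kappa> bp (ray_image \<beta>) n"
      using sub by (auto simp: ray_image_def)
    then obtain s where s: "0 \<le> s" "dist (\<gamma> (real i)) (\<beta> s) \<le> (n + 1) * \<kappa> (dist bp (\<gamma> (real i)))"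
      using kappa_nbhd_obtain[OF K, of "\<gamma> (real i)" bp "ray_image \<beta>" n] by (auto simp: ray_image_def)
    moreover have "(n + 1) * \<kappa> (dist bp (\<gamma> (real i))) \<le> N * \<kappa> (dist bp (\<gamma> (real i)))"
      using \<kappa>1[of "\<gamma> (real i)"] by (intro mult_right_mono) (auto simp: N_def)
    ultimately show ?thesis
      by auto
  qed
  then obtain \<sigma>0 where \<sigma>0: "\<And>i. 0 \<le> \<sigma>0 i" "\<And>i. dist (\<gamma> (real i)) (\<beta> (\<sigma>0 i)) \<le> N * \<kappa> (dist bp (\<gamma> (real i)))"
    by metis
  \<comment> \<open>Setting \<open>\<sigma> 0 = 0\<close> ensures that the first index with
    \<open>s < \<sigma> i\<close> is never 0 and so has a predecessor.\<close>
  define \<sigma> where "\<sigma> i = (if i = 0 then 0 else \<sigma>0 i)" for i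
  have \<sigma>: "0 \<le> \<sigma> i" "dist (\<gamma> (real i)) (\<beta> (\<sigma> i)) \<le> N * \<kappa> (dist bp (\<gamma> (real i)))" for i
    using \<sigma>0[of i] N \<kappa>1[of "\<gamma> 0"] qg_ray_withD(1)[OF \<beta>] qg_ray_withD(1)[OF \<gamma>]
    by (auto simp: \<sigma>_def)
  \<comment> \<open>If \<open>\<sigma>\<close> were bounded, so would be the points
    \<open>\<beta> (\<sigma> i)\<close>. The slope \<open>1 / (2 * N)\<close> absorbs
    \<open>N * \<kappa>\<close> into half of \<open>dist bp (\<gamma> (real i))\<close>, so the
    points of \<open>\<gamma>\<close> would be bounded too.\<close>
  have unbounded: "\<exists>i. s < \<sigma> i" for s
  proof (rule ccontr)
    assume "\<not> (\<exists>i. s < \<sigma> i)"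
    then have le: "\<sigma> i \<le> s" for i
      by (simp add: not_less)
    obtain k where k: "0 \<le> k" "\<And>t. 0 \<le> t \<Longrightarrow> \<kappa> t \<le> 1 / (2 * N) * t + k"
      using sublinear_linear_bound[OF K, of "1 / (2 * N)"] N by auto
    have "real i \<le> q' * (2 * (q * s + Q + N * k) + Q')" for i
    proof -
      define l where "l = dist bp (\<gamma> (real i))"
      have "N * \<kappa> l \<le> N * (1 / (2 * N) * l + k)"
        using k(2)[of l] N by (intro mult_left_mono) (auto simp: l_def)
      also have "\<dots> = l / 2 + N * k"
        using N by (simp add: field_simps)
      finally have "dist (\<gamma> (real i)) (\<beta> (\<sigma> i)) \<le> l / 2 + N * k"
        using \<sigma>(2)[of i] by (simp add: l_def)
      moreover have "dist bp (\<beta> (\<sigma> i)) \<le> q * s + Q"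
      proof -
        have "q * \<sigma> i \<le> q * s"
          using le[of i] q by (intro mult_left_mono) auto
        then show ?thesis
          using qg_ray_withD(1)[OF \<beta>] qg_ray_withD(4)[OF \<beta>, of 0 "\<sigma> i"] \<sigma>(1)[of i] by simp
      qed
      ultimately have "l \<le> 2 * (q * s + Q + N * k)"
        using dist_triangle2[of bp "\<gamma> (real i)" "\<beta> (\<sigma> i)"] by (simp add: l_def)
      moreover have "real i / q' - Q' \<le> l"
        using qg_ray_withD(1)[OF \<gamma>] qg_ray_withD(3)[OF \<gamma>, of 0 "real i"] by (simp add: l_def)
      ultimately have "real i / q' \<le> 2 * (q * s + Q + N * k) + Q'"
        by simp
      then show ?thesis
        using q' by (simp add: pos_divide_le_eq mult.commute)
    qed
    then show False
      using reals_Archimedean2 by (metis not_less)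
  qed
  obtain K1 where K1: "1 \<le> K1" "\<And>x y bp::'a. dist x y \<le> (q' + Q') * \<kappa> (dist bp x) \<Longrightarrow>
       \<kappa> (dist bp y) \<le> K1 * \<kappa> (dist bp x) \<and> \<kappa> (dist bp x) \<le> K1 * \<kappa> (dist bp y)"
    using sublinear_comparable[OF K, where C="q' + Q'" and 'a='a] by blast
  define C where "C = q * (q * (N * K1 + N + q' + Q' + Q)) + Q + N"
  obtain K2 where K2: "1 \<le> K2" "\<And>x y bp::'a. dist x y \<le> C * \<kappa> (dist bp x) \<Longrightarrow>
       \<kappa> (dist bp y) \<le> K2 * \<kappa> (dist bp x) \<and> \<kappa> (dist bp x) \<le> K2 * \<kappa> (dist bp y)"
    using sublinear_comparable[OF K, where C=C and 'a='a] by blast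
  have "\<beta> s \<in> kappa_nbhd \<kappa> bp (ray_image \<gamma>) (C * K2)" if s: "0 \<le> s" for s
  proof -
    \<comment> \<open>The neighbouring indices give \<open>\<sigma> j \<le> s < \<sigma> i\<close>.
      As \<open>\<gamma>\<close> moves little between them, this traps \<open>s\<close> in an
      interval of length of order \<open>\<mu>\<close>.\<close>
    define i where "i = (LEAST i. s < \<sigma> i)"
    have i: "s < \<sigma> i"
      unfolding i_def using unbounded by (rule LeastI_ex)
    then obtain j where j: "i = Suc j"
      using s by (cases i) (auto simp: \<sigma>_def)
    have "\<not> s < \<sigma> j"
      using not_less_Least[of j "\<lambda>i. s < \<sigma> i"] j unfolding i_def by simp
    then have js: "\<sigma> j \<le> s"
      by simp
    define \<mu> where "\<mu> = \<kappa> (dist bp (\<gamma> (real j)))"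
    have \<mu>: "1 \<le> \<mu>"
      using \<kappa>1 by (simp add: \<mu>_def)
    have "dist (\<gamma> (real j)) (\<gamma> (real i)) \<le> q' + Q'"
      using qg_ray_withD(4)[OF \<gamma>, of "real j" "real i"] by (simp add: j)
    moreover have "(q' + Q') * 1 \<le> (q' + Q') * \<mu>"
      using \<mu> q' by (intro mult_left_mono) auto
    ultimately have jump: "dist (\<gamma> (real j)) (\<gamma> (real i)) \<le> (q' + Q') * \<mu>"
      by simp
    have "N * \<kappa> (dist bp (\<gamma> (real i))) \<le> N * (K1 * \<mu>)"
      using K1(2)[OF jump[unfolded \<mu>_def]] N by (intro mult_left_mono) (auto simp: \<mu>_def)
    then have "dist (\<beta> (\<sigma> j)) (\<beta> (\<sigma> i)) \<le> (N * K1 + N + q' + Q') * \<mu>"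
      using \<sigma>(2)[of i] \<sigma>(2)[of j] jump dist_triangle3[of "\<beta> (\<sigma> j)" "\<beta> (\<sigma> i)" "\<gamma> (real j)"]
        dist_triangle[of "\<gamma> (real j)" "\<beta> (\<sigma> i)" "\<gamma> (real i)"]
      by (simp add: \<mu>_def algebra_simps)
    moreover have Q\<mu>: "Q * 1 \<le> Q * \<mu>"
      using \<mu> q by (intro mult_left_mono) auto
    moreover have "(\<sigma> i - \<sigma> j) / q - Q \<le> dist (\<beta> (\<sigma> j)) (\<beta> (\<sigma> i))"
      using i js \<sigma>(1)[of j] by (intro qg_ray_withD(3)[OF \<beta>]) auto
    ultimately have "(\<sigma> i - \<sigma> j) / q \<le> (N * K1 + N + q' + Q' + Q) * \<mu>"
      by (simp add: algebra_simps)
    then have "s - \<sigma> j \<le> q * ((N * K1 + N + q' + Q' + Q) * \<mu>)"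
      using q i by (simp add: pos_divide_le_eq mult.commute)
    then have "q * (s - \<sigma> j) \<le> q * (q * ((N * K1 + N + q' + Q' + Q) * \<mu>))"
      using q by (intro mult_left_mono) auto
    moreover have "dist (\<beta> (\<sigma> j)) (\<beta> s) \<le> q * (s - \<sigma> j) + Q"
      using js \<sigma>(1)[of j] by (intro qg_ray_withD(4)[OF \<beta>])
    ultimately have "dist (\<beta> (\<sigma> j)) (\<beta> s) \<le> (C - N) * \<mu>"
      using Q\<mu> by (simp add: C_def algebra_simps)
    then have near: "dist (\<gamma> (real j)) (\<beta> s) \<le> C * \<mu>"
      using \<sigma>(2)[of j] dist_triangle[of "\<gamma> (real j)" "\<beta> s" "\<beta> (\<sigma> j)"] by (simp add: \<mu>_def algebra_simps)
    have "0 \<le> C"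
      using q q' N K1(1) by (simp add: C_def)
    have "infdist (\<beta> s) (ray_image \<gamma>) \<le> C * \<mu>"
      using near by (intro infdist_le2[of "\<gamma> (real j)"]) (auto simp: ray_image_def dist_commute)
    also have "\<dots> \<le> C * (K2 * \<kappa> (dist bp (\<beta> s)))"
      using K2(2)[OF near[unfolded \<mu>_def]] \<open>0 \<le> C\<close> by (intro mult_left_mono) (auto simp: \<mu>_def)
    finally show ?thesis
      by (simp add: kappa_nbhd_def)
  qed
  then show ?thesis
    by (intro that[of "C * K2"]) (auto simp: ray_image_def)
qed

section \<open>A geodesic ray near a Morse quasi-geodesic ray\<close>

lemma compact_product:
  fixes S :: "'i \<Rightarrow> 'a::topological_space set"
  assumes "\<And>i. compact (S i)"
  shows "compact {f. \<forall>i. f i \<in> S i}"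
proof -
  have "{f. \<forall>i. f i \<in> S i} = PiE UNIV S"
    by auto
  moreover have "compactin (product_topology (\<lambda>_. euclidean) UNIV) (PiE UNIV S)"
    using assms by (subst compactin_PiE) auto
  ultimately show ?thesis
    by (simp add: euclidean_product_topology)
qed

lemma kappa_morse_obtain:
  assumes "kappa_morse \<kappa> bp Z" "1 \<le> q" "0 \<le> Q"
  obtains m where "\<And>\<alpha> a b. qg_segment q Q \<alpha> a b \<Longrightarrow> \<alpha> a \<in> Z \<Longrightarrow> \<alpha> b \<in> Z \<Longrightarrow>
    \<alpha> ` {a..b} \<subseteq> kappa_nbhd \<kappa> bp Z m"
proof -
  obtain m where "\<forall>q Q \<alpha> a b. q \<ge> 1 \<and> Q \<ge> 0 \<and> qg_segment q Q \<alpha> a b \<and> \<alpha> a \<in> Z \<and> \<alpha> b \<in> Z \<longrightarrow>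
      \<alpha> ` {a..b} \<subseteq> kappa_nbhd \<kappa> bp Z (m q Q)"
    using assms(1) unfolding kappa_morse_def by (elim conjE exE)
  then show ?thesis
    using assms(2,3) by (intro that[of "m q Q"]) simp
qed

text \<open>The geodesics from \<open>bp\<close> to points \<open>\<beta> n\<close> stay near \<open>\<beta>\<close>; by Tychonoff's theorem they have a
  pointwise limit.\<close>

lemma morse_geodesic_ray:
  fixes bp :: "'a::metric_space"
  assumes proper: "proper_space TYPE('a)" and geo: "geodesic_space TYPE('a)"
    and ray: "qg_ray bp \<beta>" and morse: "kappa_morse \<kappa> bp (ray_image \<beta>)"
  obtains b m where "geodesic_ray bp b" "ray_image b \<subseteq> kappa_nbhd \<kappa> bp (ray_image \<beta>) m"
proof -
  obtain q Q where q: "1 \<le> q" "0 \<le> Q" and \<beta>: "qg_ray_with bp q Q \<beta>"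
    using ray by (auto simp: qg_ray_def)
  define Z where "Z = ray_image \<beta>"
  obtain m where m: "\<And>\<alpha> a b. qg_segment 1 0 \<alpha> a b \<Longrightarrow> \<alpha> a \<in> Z \<Longrightarrow> \<alpha> b \<in> Z \<Longrightarrow>
      \<alpha> ` {a..b} \<subseteq> kappa_nbhd \<kappa> bp Z m"
    using kappa_morse_obtain[OF morse, of 1 0] by (auto simp: Z_def)
  define P where "P = {f :: real \<Rightarrow> 'a. \<forall>t. f t \<in> cball bp \<bar>t\<bar>}"
  \<comment> \<open>Closed conditions on the ray up to time \<open>T\<close>. Evaluating
    \<open>\<kappa>\<close> at \<open>t\<close>, which equals \<open>dist bp (f t)\<close> here,
    makes the last one closed by continuity of \<open>infdist\<close> alone.\<close>
  define F where "F T = {f :: real \<Rightarrow> 'a. f 0 = bp} \<inter>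
      (\<Inter>s\<in>{0..T}. \<Inter>t\<in>{0..T}. {f. dist (f s) (f t) = \<bar>s - t\<bar>}) \<inter>
      (\<Inter>t\<in>{0..T}. {f. infdist (f t) Z \<le> m * \<kappa> t})" for T
  have "compact P"
    unfolding P_def using proper by (intro compact_product) (auto simp: proper_space_def)
  moreover have "closed (F T)" for T
    unfolding F_def
    by (intro closed_Int closed_INT ballI closed_Collect_eq closed_Collect_le continuous_intros
        continuous_on_product_coordinates continuous_on_infdist)
  \<comment> \<open>For finitely many \<open>T\<close>, one geodesic segment that outlasts the
    largest of them suffices.\<close>
  moreover have "P \<inter> (\<Inter>T\<in>I. F T) \<noteq> {}" if I: "finite I" for I
  proof -
    define T where "T = Max (insert 0 I)"
    have T: "0 \<le> T" "\<And>t. t \<in> I \<Longrightarrow> t \<le> T"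
      using I by (auto simp: T_def)
    \<comment> \<open>At this parameter the lower quasi-geodesic bound puts \<open>\<beta> n\<close>
      at distance at least \<open>T\<close> from \<open>bp\<close>.\<close>
    define n where "n = q * (T + Q)"
    have n: "0 \<le> n"
      using q T by (simp add: n_def)
    define L where "L = dist bp (\<beta> n)"
    have "n / q - Q \<le> L"
      using qg_ray_withD(1)[OF \<beta>] qg_ray_withD(3)[OF \<beta>, of 0 n] n by (simp add: L_def)
    then have TL: "T \<le> L"
      using q by (simp add: n_def)
    obtain g where g: "geodesic_segment g bp (\<beta> n)"
      using geo by (auto simp: geodesic_space_def)
    have gd: "dist (g s) (g t) = \<bar>s - t\<bar>" if "s \<in> {0..L}" "t \<in> {0..L}" for s t
      using geodesic_segmentD(3)[OF g] that by (simp add: L_def)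
    have g0: "dist bp (g t) = t" if "t \<in> {0..L}" for t
      using geodesic_segment_dist(1)[OF g] that by (simp add: L_def)
    have "qg_segment 1 0 g 0 L"
      by (rule isometric_qg_segment[OF gd]) (auto simp: L_def)
    moreover have "g 0 \<in> Z" "g L \<in> Z"
      using geodesic_segmentD(1,2)[OF g] base_in_ray_image[OF ray] n by (auto simp: L_def Z_def ray_image_def)
    ultimately have gN: "g ` {0..L} \<subseteq> kappa_nbhd \<kappa> bp Z m"
      by (rule m)
    have gZ: "infdist (g t) Z \<le> m * \<kappa> t" if "t \<in> {0..L}" for t
    proof -
      have "g t \<in> kappa_nbhd \<kappa> bp Z m"
        using gN that by blast
      then show ?thesis
        using g0[OF that] by (simp add: kappa_nbhd_def)
    qed
    \<comment> \<open>Clamping the parameter keeps \<open>f\<close> in \<open>P\<close> at all real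
      \<open>t\<close>, also outside \<open>{0..L}\<close>.\<close>
    define f where "f t = g (max 0 (min t L))" for t
    have f: "f t = g t" if "t \<in> {0..L}" for t
      using that by (simp add: f_def max_def min_def)
    have "f \<in> P"
      using g0 by (auto simp: P_def f_def L_def)
    moreover have "f \<in> F t" if "t \<in> I" for t
    proof -
      have "f 0 = bp"
        using f[of 0] geodesic_segmentD(1)[OF g] by (simp add: L_def)
      then show ?thesis
        using T(2)[OF that] TL by (auto simp: F_def f gd gZ)
    qed
    ultimately show ?thesis
      by auto
  qed
  ultimately have "P \<inter> (\<Inter>T\<in>UNIV. F T) \<noteq> {}"
    by (rule compact_imp_fip_image)
  then obtain b where b: "\<And>T. b \<in> F T"
    by auto
  have "b 0 = bp"
    using b[of 0] by (simp add: F_def)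
  moreover have bd: "dist (b s) (b t) = \<bar>s - t\<bar>" if "0 \<le> s" "0 \<le> t" for s t
    using b[of "max s t"] that by (simp add: F_def)
  ultimately have gray: "geodesic_ray bp b"
    by (simp add: geodesic_ray_def)
  have "b t \<in> kappa_nbhd \<kappa> bp Z m" if "0 \<le> t" for t
    using b[of t] bd[of 0 t] \<open>b 0 = bp\<close> that by (simp add: F_def kappa_nbhd_def)
  then show ?thesis
    using that[OF gray, of m] by (auto simp: Z_def ray_image_def)
qed

section \<open>Equivalence of the five conditions\<close>

theorem theorem3p5:
  fixes \<kappa> :: "real \<Rightarrow> real" and bp :: "'a::metric_space" and \<beta>0 :: "real \<Rightarrow> 'a"
  assumes "proper_space TYPE('a)" and "CAT0 TYPE('a)"
    and "sublinear_fn \<kappa>"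
    and "qg_ray bp \<beta>0"
  defines "B \<equiv> kappa_class \<kappa> bp \<beta>0"
  shows
   "let P1 = (\<exists>b\<in>B. geodesic_ray bp b \<and> kappa_contracting \<kappa> bp (ray_image b));
        P2 = (\<forall>\<beta>\<in>B. kappa_contracting \<kappa> bp (ray_image \<beta>));
        P3 = (\<forall>\<beta>\<in>B. kappa_morse \<kappa> bp (ray_image \<beta>));
        P4 = (\<exists>\<beta>\<in>B. kappa_morse \<kappa> bp (ray_image \<beta>));
        P5 = (\<exists>b\<in>B. geodesic_ray bp b \<and>
               (\<exists>M. \<forall>\<alpha> s t. qg_segment 32 0 \<alpha> s t \<and>
                   \<alpha> s \<in> ray_image b \<and> \<alpha> t \<in> ray_image b \<longrightarrow>
                   \<alpha> ` {s..t} \<subseteq> kappa_nbhd \<kappa> bp (ray_image b) M))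
    in (P1 \<longleftrightarrow> P2) \<and> (P2 \<longleftrightarrow> P3) \<and> (P3 \<longleftrightarrow> P4) \<and> (P4 \<longleftrightarrow> P5)"
proof -
  note proper = assms(1) and cat = assms(2) and K = assms(3)
  have geo: "geodesic_space TYPE('a)"
    using cat by (simp add: CAT0_def)
  have qg: "qg_ray bp \<beta>" if "\<beta> \<in> B" for \<beta>
    using that by (simp add: B_def kappa_class_def)
  have \<beta>0: "\<beta>0 \<in> B"
  proof -
    have "x \<in> kappa_nbhd \<kappa> bp (ray_image \<beta>0) 0" if "x \<in> ray_image \<beta>0" for x
      using that by (simp add: kappa_nbhd_def)
    then show ?thesis
      using assms(4) by (auto simp: B_def kappa_class_def kappa_fellow_def)
  qed
  have fellow: "kappa_fellow \<kappa> bp \<beta> \<gamma>" if "\<beta> \<in> B" "\<gamma> \<in> B" for \<beta> \<gamma>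
    using that kappa_fellow_trans[OF K, of bp \<beta> \<beta>0 \<gamma>] kappa_fellow_sym[of \<kappa> bp \<beta>0 \<beta>]
    by (simp add: B_def kappa_class_def)
  have transfer: "kappa_contracting \<kappa> bp (ray_image \<gamma>)"
    if \<beta>: "\<beta> \<in> B" "kappa_contracting \<kappa> bp (ray_image \<beta>)" and \<gamma>: "\<gamma> \<in> B" for \<beta> \<gamma>
  proof -
    obtain n m where "ray_image \<beta> \<subseteq> kappa_nbhd \<kappa> bp (ray_image \<gamma>) n"
      "ray_image \<gamma> \<subseteq> kappa_nbhd \<kappa> bp (ray_image \<beta>) m"
      using fellow[OF \<beta>(1) \<gamma>] by (auto simp: kappa_fellow_def)
    then show ?thesis
      by (rule contracting_transfer[OF K proper geo \<beta>(2) closed_ray_image[OF qg[OF \<gamma>]]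
            base_in_ray_image[OF qg[OF \<beta>(1)]] base_in_ray_image[OF qg[OF \<gamma>]]])
  qed
  have morse_contracting: "kappa_contracting \<kappa> bp (ray_image \<beta>)"
    if \<beta>: "\<beta> \<in> B" and M: "morse_32 \<kappa> bp M (ray_image \<beta>)" for \<beta> M
  proof -
    have bp: "bp \<in> ray_image \<beta>"
      by (rule base_in_ray_image[OF qg[OF \<beta>]])
    then have "ray_image \<beta> \<noteq> {}"
      by auto
    then show ?thesis
      using morse_32_imp_contracting[OF K cat bp M] closed_ray_image[OF qg[OF \<beta>]]
      by (subst kappa_contracting_iff[OF K proper]) (auto intro!: exI[of _ "2000 * \<bar>M\<bar> + 1"])
  qed
  have morse_32: "\<exists>M. morse_32 \<kappa> bp M (ray_image \<beta>)" if "kappa_morse \<kappa> bp (ray_image \<beta>)" for \<beta>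
    by (rule kappa_morse_obtain[OF that, of 32 0]) (simp, simp, unfold morse_32_def, blast)
  define P1 where "P1 \<longleftrightarrow> (\<exists>b\<in>B. geodesic_ray bp b \<and> kappa_contracting \<kappa> bp (ray_image b))"
  define P2 where "P2 \<longleftrightarrow> (\<forall>\<beta>\<in>B. kappa_contracting \<kappa> bp (ray_image \<beta>))"
  define P3 where "P3 \<longleftrightarrow> (\<forall>\<beta>\<in>B. kappa_morse \<kappa> bp (ray_image \<beta>))"
  define P4 where "P4 \<longleftrightarrow> (\<exists>\<beta>\<in>B. kappa_morse \<kappa> bp (ray_image \<beta>))"
  define P5 where "P5 \<longleftrightarrow> (\<exists>b\<in>B. geodesic_ray bp b \<and> (\<exists>M. morse_32 \<kappa> bp M (ray_image b)))"
  \<comment> \<open>The implications form the cycle 2, 3, 4, 2 and the chain 3, 5, 1, 2.\<close>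
  have 12: "P1 \<Longrightarrow> P2"
    using transfer by (auto simp: P1_def P2_def)
  have 23: "P2 \<Longrightarrow> P3"
    using contracting_imp_morse[OF K proper] by (auto simp: P2_def P3_def)
  have 34: "P3 \<Longrightarrow> P4"
    using \<beta>0 by (auto simp: P3_def P4_def)
  have 42: "P4 \<Longrightarrow> P2"
    using morse_32 morse_contracting transfer unfolding P4_def P2_def by blast
  have 51: "P5 \<Longrightarrow> P1"
    using morse_contracting unfolding P5_def P1_def by blast
  \<comment> \<open>The ray is near \<open>\<beta>0\<close> by construction;
    \<open>qg_ray_nbhd_sym\<close> supplies the reverse inclusion, which puts it in the
    class.\<close>
  have geodesic: "\<exists>b\<in>B. geodesic_ray bp b" if P3
  proof -
    have "kappa_morse \<kappa> bp (ray_image \<beta>0)"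
      using that \<beta>0 by (simp add: P3_def)
    then obtain b n where b: "geodesic_ray bp b" and n: "ray_image b \<subseteq> kappa_nbhd \<kappa> bp (ray_image \<beta>0) n"
      using morse_geodesic_ray[OF proper geo assms(4)] by blast
    have qb: "qg_ray bp b"
      using geodesic_ray_qg_ray[OF b] by (force simp: qg_ray_def)
    obtain m where "ray_image \<beta>0 \<subseteq> kappa_nbhd \<kappa> bp (ray_image b) m"
      using qg_ray_nbhd_sym[OF K assms(4) qb n] .
    then have "b \<in> B"
      using n qb by (auto simp: B_def kappa_class_def kappa_fellow_def)
    then show ?thesis
      using b by blast
  qed
  have 35: "P3 \<Longrightarrow> P5"
    using geodesic morse_32 unfolding P3_def P5_def by blast
  have "(P1 \<longleftrightarrow> P2) \<and> (P2 \<longleftrightarrow> P3) \<and> (P3 \<longleftrightarrow> P4) \<and> (P4 \<longleftrightarrow> P5)"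
    using 12 23 34 42 51 35 by blast
  then show ?thesis
    unfolding Let_def P1_def P2_def P3_def P4_def P5_def morse_32_def .
qed

end
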